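(* Let $n\ge 1$ and let $\mathbf{C}_n=\{(x_1,\dots,x_n):1\le x_1\le 2,\ 1\le x_i\le 2x_{i-1}\ (2\le i\le n)\}$. For every labeled tree $T$ on the node set $\{1,\dots,n+1\}$, let the node with label $k$ have NFS position $i_k$ and let $j_k$ be the number of cane paths of $T$ starting at it, and set $$\mathbf{S}_T=\{(x_1,\dots,x_n):\ 1\le x_{i_1}/2^{j_1}\le x_{i_2}/2^{j_2}\le\dots\le x_{i_n}/2^{j_n}\le 2\}.$$ Then $\mathbf{S}_T$ is a simplex and $$n!\operatorname{vol}\mathbf{S}_T=\bigl|\{G \text{ connected labeled graph on }\{1,\dots,n+1\}:\ \Phi(G)=T\}\bigr| = 2^{\alpha(T)}.$$ Furthermore, the simplices $\mathbf{S}_T$, $T$ ranging over all labeled trees on $\{1,\dots,n+1\}$, form a triangulation of $\mathbf{C}_n$. In particular $n!\operatorname{vol}\mathbf{C}_n$ equals the number of connected labeled graphs on $n+1$ nodes.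
   Context: Labeled forest conventions: in a labeled forest on $\{1,\dots,n+1\}$ each component is rooted at its node of largest label, the children of every node are ordered from left to right by increasing label, and components are ordered from left to right by decreasing largest label. NFS positions in a forest on $n+1$ nodes: each node gets a position in $\{0,\dots,n\}$. Components are processed from left to right; when a component is begun, its root gets the next unused position (so the root of the leftmost component gets $0$). Within a component the root is initially active; the children of the active node receive the next consecutive positions from right to left, and then the leftmost of these children becomes active; if the active node has no children, the most recently positioned node that has not yet been active becomes active; the component is finished when no such node remains. Cane paths: a cane path in a rooted forest is a path $v_0,v_1,\dots,v_k$ with $k\ge 2$ such that each of the first $k-1$ steps goes from a node to its parent and the last step goes from $v_{k-1}$ to a child of $v_{k-1}$ lying to the right of $v_{k-2}$. $\alpha(F)$ denotes the total number of cane paths in $F$. Neighbors-first search (NFS) of a labeled graph $G$ on $\{1,\dots,n+1\}$: the components of $G$ are processed in order of decreasing maximal label. In a component, its node of maximal label is visited first and made active. At each step, the previously unvisited neighbours of the active node are visited in decreasing order of their labels, each being joined to the active node by a search edge, and the one with smallest label becomes the new active node; if the active node has no unvisited neighbours, the most recently visited node that has not yet been active becomes active. The search edges form a spanning forest $\Phi(G)$ (a spanning tree if $G$ is connected). A triangulation of a polytope $P\subset\mathbb{R}^n$ is a set of $n$-simplices whose union is $P$ and whose interiors are pairwise disjoint. *)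

theory Defs
  imports "HOL-Analysis.Analysis" "HOL-Library.While_Combinator"
begin

section \<open>Labeled graphs and trees\<close>

text \<open>A (simple) labeled graph on the node set \<open>{1..N}\<close> is represented by its set of edges,
  an edge being a two-element set of nodes.\<close>

type_synonym lgraph = "nat set set"

definition labeled_graph :: "nat \<Rightarrow> lgraph \<Rightarrow> bool" where
  "labeled_graph N G \<longleftrightarrow> (\<forall>E\<in>G. \<exists>u v. E = {u, v} \<and> u \<in> {1..N} \<and> v \<in> {1..N} \<and> u \<noteq> v)"

abbreviation adjacent :: "lgraph \<Rightarrow> nat \<Rightarrow> nat \<Rightarrow> bool" where
  "adjacent G u v \<equiv> {u, v} \<in> G"

definition lg_component :: "nat \<Rightarrow> lgraph \<Rightarrow> nat \<Rightarrow> nat set" where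
  "lg_component N G v = {u \<in> {1..N}. (adjacent G)\<^sup>*\<^sup>* v u}"

definition lg_connected :: "nat \<Rightarrow> lgraph \<Rightarrow> bool" where
  "lg_connected N G \<longleftrightarrow> (\<forall>u\<in>{1..N}. \<forall>v\<in>{1..N}. (adjacent G)\<^sup>*\<^sup>* u v)"

definition lg_path :: "lgraph \<Rightarrow> nat list \<Rightarrow> bool" where
  "lg_path G p \<longleftrightarrow> p \<noteq> [] \<and> distinct p \<and> successively (adjacent G) p"

definition lg_cycle :: "lgraph \<Rightarrow> nat list \<Rightarrow> bool" where
  "lg_cycle G p \<longleftrightarrow> lg_path G p \<and> 3 \<le> length p \<and> adjacent G (last p) (hd p)"

definition labeled_tree :: "nat \<Rightarrow> lgraph \<Rightarrow> bool" where
  "labeled_tree N T \<longleftrightarrow> labeled_graph N T \<and> lg_connected N T \<and> \<not> (\<exists>p. lg_cycle T p)"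


section \<open>Labeled forests as ordered rooted forests\<close>

text \<open>The components of a labeled forest are rooted at their node of largest label. Siblings are
  ordered from left to right by increasing label, so a sibling lies to the right of another one
  if and only if its label is larger.\<close>

definition lg_root :: "nat \<Rightarrow> lgraph \<Rightarrow> nat \<Rightarrow> nat" where
  "lg_root N F v = Max (lg_component N F v)"

text \<open>\<open>w\<close> is a child of \<open>v\<close> if \<open>v\<close> is the last node before \<open>w\<close> on the path from the root to \<open>w\<close>.\<close>

definition children :: "nat \<Rightarrow> lgraph \<Rightarrow> nat \<Rightarrow> nat set" where
  "children N F v =
     {w \<in> {1..N}. \<exists>p. lg_path F (p @ [v, w]) \<and> hd (p @ [v, w]) = lg_root N F w}"

text \<open>A cane path \<open>v\<^sub>0, \<dots>, v\<^sub>k\<close> is the list \<open>p\<close> with \<open>p ! i = v\<^sub>i\<close>, of length \<open>k + 1\<close>.\<close>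

definition cane_path :: "nat \<Rightarrow> lgraph \<Rightarrow> nat list \<Rightarrow> bool" where
  "cane_path N F p \<longleftrightarrow>
     (\<exists>k\<ge>2. length p = k + 1 \<and>
       (\<forall>i<k - 1. p ! i \<in> children N F (p ! (i + 1))) \<and>
       p ! k \<in> children N F (p ! (k - 1)) \<and> p ! (k - 2) < p ! k)"

definition cane_paths_from :: "nat \<Rightarrow> lgraph \<Rightarrow> nat \<Rightarrow> nat" where
  "cane_paths_from N F v = card {p. cane_path N F p \<and> hd p = v}"

definition cane_paths_total :: "nat \<Rightarrow> lgraph \<Rightarrow> nat" where
  "cane_paths_total N F = card {p. cane_path N F p}"


section \<open>Neighbors-first search\<close>

text \<open>Both the NFS positions in a forest and the neighbors-first search of a graph are instances of
  one procedure. It is parametrized by the set \<open>new V a\<close> of nodes that are to be visited when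
  \<open>a\<close> is active and \<open>V\<close> is the set of nodes visited so far: for a forest these are the children
  of \<open>a\<close>, for a graph the neighbours of \<open>a\<close> not in \<open>V\<close>. The list \<open>visited\<close> is in order of
  visits, and the search of a component ends when there is no active node any more.\<close>

record nfs_state =
  visited :: "nat list"
  been_active :: "nat set"
  active :: "nat option"
  search_edges :: "nat set set"

definition nfs_init :: "nat \<Rightarrow> nfs_state" where
  "nfs_init r = \<lparr>visited = [r], been_active = {r}, active = Some r, search_edges = {}\<rparr>"

definition nfs_step :: "(nat set \<Rightarrow> nat \<Rightarrow> nat set) \<Rightarrow> nfs_state \<Rightarrow> nfs_state" where
  "nfs_step new s =
     (let a = the (active s);
          U = new (set (visited s)) a;
          vs = visited s @ rev (sorted_list_of_set U);
          waiting = filter (\<lambda>v. v \<notin> been_active s) vs;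
          next = (if U \<noteq> {} then Some (Min U)
                  else if waiting \<noteq> [] then Some (last waiting) else None)
      in \<lparr>visited = vs,
          been_active = been_active s \<union> set_option next,
          active = next,
          search_edges = search_edges s \<union> (\<lambda>u. {a, u}) ` U\<rparr>)"

definition nfs_component :: "(nat set \<Rightarrow> nat \<Rightarrow> nat set) \<Rightarrow> nat \<Rightarrow> nfs_state" where
  "nfs_component new r = while (\<lambda>s. active s \<noteq> None) (nfs_step new) (nfs_init r)"

text \<open>The roots of the components, in the order in which the components are processed.\<close>

definition nfs_roots :: "nat \<Rightarrow> lgraph \<Rightarrow> nat list" where
  "nfs_roots N G = rev (sorted_list_of_set (lg_root N G ` {1..N}))"

definition nfs_order :: "nat \<Rightarrow> lgraph \<Rightarrow> nat list" where
  "nfs_order N F =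
     concat (map (\<lambda>r. visited (nfs_component (\<lambda>_ a. children N F a) r)) (nfs_roots N F))"

definition nfs_position :: "nat \<Rightarrow> lgraph \<Rightarrow> nat \<Rightarrow> nat" where
  "nfs_position N F v = (THE i. i < length (nfs_order N F) \<and> nfs_order N F ! i = v)"

text \<open>The spanning forest \<open>\<Phi>(G)\<close> of all search edges.\<close>

definition nfs_forest :: "nat \<Rightarrow> lgraph \<Rightarrow> lgraph" where
  "nfs_forest N G =
     \<Union> (set (map (\<lambda>r. search_edges (nfs_component (\<lambda>V a. {u. adjacent G a u \<and> u \<notin> V}) r))
                (nfs_roots N G)))"


section \<open>Polytopes and triangulations\<close>

text \<open>This differs from \<^const>\<open>triangulation\<close>, which requires the simplices to intersect in common
  faces.\<close>

definition polytope_triangulation :: "(real ^ 'n) set set \<Rightarrow> (real ^ 'n) set \<Rightarrow> bool" where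
  "polytope_triangulation \<T> P \<longleftrightarrow>
     polytope P \<and> (\<forall>S\<in>\<T>. int CARD('n) simplex S) \<and> \<Union>\<T> = P \<and>
     pairwise (\<lambda>S S'. interior S \<inter> interior S' = {}) \<T>"

text \<open>Points of n-dimensional space are vectors in \<open>real ^ 'n\<close>, and \<open>e\<close> is an enumeration
  of the index type by \<open>{1..n}\<close>, so that \<open>x $ e i\<close> is the coordinate \<open>x\<^sub>i\<close>.\<close>

definition cayley_polytope :: "(nat \<Rightarrow> 'n) \<Rightarrow> nat \<Rightarrow> (real ^ 'n) set" where
  "cayley_polytope e n =
     {x. 1 \<le> x $ e 1 \<and> x $ e 1 \<le> 2 \<and>
         (\<forall>i\<in>{2..n}. 1 \<le> x $ e i \<and> x $ e i \<le> 2 * x $ e (i - 1))}"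

definition tree_simplex :: "(nat \<Rightarrow> 'n) \<Rightarrow> nat \<Rightarrow> lgraph \<Rightarrow> (real ^ 'n) set" where
  "tree_simplex e n T =
     {x. let y = (\<lambda>k. x $ e (nfs_position (n + 1) T k) / 2 ^ cane_paths_from (n + 1) T k)
         in 1 \<le> y 1 \<and> (\<forall>k\<in>{1..<n}. y k \<le> y (k + 1)) \<and> y n \<le> 2}"

end

theory Submission
  imports Defs
begin

text \<open>
  Neighbors-first search keeps its waiting nodes on a stack. When a node \<open>v\<close> becomes active, the nodes
  below it in the stack are the right siblings of \<open>v\<close> and of its ancestors, so they are exactly the
  end points of the cane paths from \<open>v\<close>. Adding an edge from \<open>v\<close> to one of them does not
  disturb the search, whereas every other additional edge does; hence \<open>2^\<alpha>(T)\<close> graphs have search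
  tree \<open>T\<close>.

  The labels in visiting order, each with its stack depth \<open>j\<close>, determine the tree, because the
  children of a node form a maximal run of depths increasing by one. The sequences that occur are those
  in which the depth starts at 0 and grows by at most one at each step, and only if the label
  decreases. Writing the coordinates of a point of the Cayley polytope as \<open>x\<^sub>i = 2^j * y\<close> with
  \<open>1 \<le> y \<le> 2\<close> and labelling positions by the rank of \<open>y\<close>, the inequality
  \<open>x\<^sub>i \<le> 2 * x\<^sub>i\<^sub>-\<^sub>1\<close> becomes the same condition. So every point lies in
  some \<open>S\<^sub>T\<close>, and in only one if the \<open>y\<close> are distinct and different from 1 and 2.
  Each simplex is a permuted and rescaled copy of one of the \<open>n!\<close> simplices into which the cube
  \<open>[1,2]\<^sup>n\<close> is cut by the order of the coordinates.
\<close>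


section \<open>Search traces\<close>

text \<open>A graph and its search tree are searched by different rules, so a run is recorded as a
  \<open>trace\<close> that mentions neither rule, and \<open>follows\<close> states separately that
  a rule produces it. One trace then serves both runs: it gives the edges of the tree, the positions
  of the nodes and, through the stack, the numbers of cane paths. Conversely every tree has a trace,
  obtained by searching the tree itself as a graph.

  The obstacle in covering the polytope is the boundary, where exponents and ranks are ambiguous.
  The exponent \<open>j\<close> is taken minimal, so \<open>y = 1\<close> occurs only with
  \<open>j = 0\<close> and the exponent cannot rise by two. Ties between equal \<open>y\<close> are
  broken in favour of the later position, because in \<open>x' = 2 * x\<close> with equal
  \<open>y\<close> the label has to decrease.

  Volume also replaces linear algebra: a positive volume makes a simplex full-dimensional, and this
  gives the affine independence of its vertices.\<close>

text \<open>A trace lists the nodes in the order in which they become active, each with the set of nodes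
  first visited from it. The waiting nodes form a stack \<open>S\<close>, with the next active node at its
  head: the smallest newly visited node becomes active next, and otherwise the most recently visited
  waiting one.\<close>

type_synonym trace = "(nat \<times> nat set) list"

fun search_trace :: "nat set \<Rightarrow> nat list \<Rightarrow> trace \<Rightarrow> bool" where
  "search_trace V [] t \<longleftrightarrow> t = []"
| "search_trace V (a # S) [] \<longleftrightarrow> False"
| "search_trace V (a # S) ((b, U) # t) \<longleftrightarrow>
     b = a \<and> finite U \<and> U \<inter> V = {} \<and> search_trace (V \<union> U) (sorted_list_of_set U @ S) t"

text \<open>Trace and rule are kept apart so that one trace can be matched both with the neighbour
  rule of a graph, which depends on \<open>V\<close>, and with the \<open>children\<close> rule of
  its tree, which does not.\<close>

fun follows :: "(nat set \<Rightarrow> nat \<Rightarrow> nat set) \<Rightarrow> nat set \<Rightarrow> trace \<Rightarrow> bool" where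
  "follows new V [] \<longleftrightarrow> True"
| "follows new V ((a, U) # t) \<longleftrightarrow> U = new V a \<and> follows new (V \<union> U) t"

text \<open>The third component is the stack left below the node at the moment it becomes active.\<close>

fun snapshots :: "nat list \<Rightarrow> trace \<Rightarrow> (nat \<times> nat set \<times> nat list) list" where
  "snapshots (a # S) ((b, U) # t) = (a, U, S) # snapshots (sorted_list_of_set U @ S) t"
| "snapshots _ _ = []"

text \<open>The second component of a code entry is the number of nodes below its node in the stack, which
  turns out to be the number of cane paths from that node.\<close>

fun visit_code :: "nat list \<Rightarrow> trace \<Rightarrow> (nat \<times> nat) list" where
  "visit_code (a # S) ((b, U) # t) =
     zip (rev (sorted_list_of_set U)) [length S..<length S + card U] @
     visit_code (sorted_list_of_set U @ S) t"
| "visit_code _ _ = []"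

definition found :: "trace \<Rightarrow> nat set" where
  "found t = \<Union> (snd ` set t)"

definition trace_edges :: "trace \<Rightarrow> lgraph" where
  "trace_edges t = {{a, u} | a U u. (a, U) \<in> set t \<and> u \<in> U}"

definition visit_list :: "trace \<Rightarrow> nat list" where
  "visit_list t = concat (map (\<lambda>(a, U). rev (sorted_list_of_set U)) t)"

lemma found_simps [simp]:
  "found [] = {}" "found ((a, U) # t) = U \<union> found t" "found (t @ t') = found t \<union> found t'"
  by (auto simp: found_def)

lemma visit_list_simps [simp]:
  "visit_list [] = []"
  "visit_list ((a, U) # t) = rev (sorted_list_of_set U) @ visit_list t"
  by (auto simp: visit_list_def)

lemma trace_edges_simps [simp]:
  "trace_edges [] = {}"
  "trace_edges ((a, U) # t) = (\<lambda>u. {a, u}) ` U \<union> trace_edges t"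
  by (auto simp: trace_edges_def)

lemma search_trace_fresh:
  "search_trace V S t \<Longrightarrow> (a, U) \<in> set t \<Longrightarrow> finite U \<and> U \<inter> V = {}"
  by (induction V S t rule: search_trace.induct) auto

lemma search_trace_found_fresh: "search_trace V S t \<Longrightarrow> found t \<inter> V = {}"
  using search_trace_fresh by (fastforce simp: found_def)

text \<open>New batches avoid \<open>V\<close>, which contains the whole stack, so no node is
  stacked twice; and the search ends only with an empty stack, so every stacked node is
  popped.\<close>

lemma search_trace_activated:
  "search_trace V S t \<Longrightarrow> distinct S \<Longrightarrow> set S \<subseteq> V \<Longrightarrow>
     distinct (map fst t) \<and> set (map fst t) = set S \<union> found t"
proof (induction V S t rule: search_trace.induct)
  case (3 V a S b U t)
  have 1: "distinct (sorted_list_of_set U @ S)" "set (sorted_list_of_set U @ S) \<subseteq> V \<union> U"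
    using 3 by auto
  have "found t \<inter> (V \<union> U) = {}"
    using 3 search_trace_found_fresh[of "V \<union> U" "sorted_list_of_set U @ S" t] by auto
  moreover have "distinct (map fst t) \<and> set (map fst t) = set (sorted_list_of_set U @ S) \<union> found t"
    using 3 1 by simp
  ultimately show ?case
    using 3 by auto
qed auto

lemma search_trace_append:
  "search_trace V S (t1 @ t2) \<Longrightarrow> distinct S \<Longrightarrow> set S \<subseteq> V \<Longrightarrow>
     \<exists>S'. search_trace (V \<union> found t1) S' t2 \<and> distinct S' \<and>
       set S' = (set S \<union> found t1) - set (map fst t1)"
proof (induction t1 arbitrary: V S)
  case (Cons x t1)
  obtain a U where x: "x = (a, U)" by fastforce
  obtain S0 where S: "S = a # S0"
    using Cons.prems x by (cases S) auto
  have 1: "search_trace (V \<union> U) (sorted_list_of_set U @ S0) (t1 @ t2)" "finite U" "U \<inter> V = {}"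
    using Cons.prems x S by auto
  then obtain S' where S': "search_trace (V \<union> U \<union> found t1) S' t2" "distinct S'"
    "set S' = (set (sorted_list_of_set U @ S0) \<union> found t1) - set (map fst t1)"
    using Cons.IH[OF 1(1)] Cons.prems S by auto
  have "a \<notin> found t1"
    using search_trace_found_fresh[OF 1(1)] Cons.prems S by auto
  then have "set S' = (set S \<union> found (x # t1)) - set (map fst (x # t1))"
    using S' S x 1 Cons.prems by auto
  with S' x show ?case
    by (auto simp: Un_assoc)
qed auto

lemma search_trace_parent_unique:
  "search_trace V S t \<Longrightarrow> (a, U) \<in> set t \<Longrightarrow> (b, W) \<in> set t \<Longrightarrow> u \<in> U \<Longrightarrow> u \<in> W \<Longrightarrow> a = b \<and> U = W"
proof (induction V S t rule: search_trace.induct)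
  case (3 V c S d X t)
  show ?case
    using 3 search_trace_fresh[of "V \<union> X" "sorted_list_of_set X @ S" t] by fastforce
qed auto

lemma set_visit_list: "search_trace V S t \<Longrightarrow> set (visit_list t) = found t"
  using search_trace_fresh by (fastforce simp: visit_list_def found_def)

lemma distinct_visit_list: "search_trace V S t \<Longrightarrow> distinct (visit_list t)"
proof (induction V S t rule: search_trace.induct)
  case (3 V c S d X t)
  then show ?case
    using search_trace_found_fresh[of "V \<union> X" "sorted_list_of_set X @ S" t]
      set_visit_list[of "V \<union> X" "sorted_list_of_set X @ S" t] by auto
qed auto

lemma map_fst_visit_code: "search_trace V S t \<Longrightarrow> map fst (visit_code S t) = visit_list t"
  by (induction V S t rule: search_trace.induct) auto

lemma snapshots_trace:
  "search_trace V S t \<Longrightarrow> map (\<lambda>(a, U, Y). (a, U)) (snapshots S t) = t"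
  by (induction V S t rule: search_trace.induct) auto

text \<open>The stack below \<open>a\<close> as a set: nodes already visited when \<open>a\<close>
  is activated and still waiting. An extra edge from \<open>a\<close> to one of these is invisible
  to the search, which looks only for unvisited neighbours.\<close>

lemma snapshots_append:
  "search_trace V S t \<Longrightarrow> (a, U, Y) \<in> set (snapshots S t) \<Longrightarrow> distinct S \<Longrightarrow> set S \<subseteq> V \<Longrightarrow>
     \<exists>t1 t2. t = t1 @ (a, U) # t2 \<and>
       set Y = (set S \<union> found t1) - insert a (set (map fst t1)) \<and> distinct Y"
proof (induction V S t rule: search_trace.induct)
  case (3 V c S d X t)
  show ?case
  proof (cases "(a, U, Y) = (c, X, S)")
    case True
    then show ?thesis
      using 3 by (intro exI[of _ "[]"] exI[of _ t]) auto
  next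
    case False
    have *: "search_trace (V \<union> X) (sorted_list_of_set X @ S) t" using 3 by auto
    moreover have "distinct (sorted_list_of_set X @ S)" "set (sorted_list_of_set X @ S) \<subseteq> V \<union> X"
      "(a, U, Y) \<in> set (snapshots (sorted_list_of_set X @ S) t)"
      using 3 False by auto
    ultimately obtain t1 t2 where t: "t = t1 @ (a, U) # t2" "distinct Y"
      "set Y = (set (sorted_list_of_set X @ S) \<union> found t1) - insert a (set (map fst t1))"
      using 3 by metis
    have "c \<notin> found t1"
      using search_trace_found_fresh[OF *] t(1) 3(2,5) by auto
    moreover have "c \<notin> set S" "c \<notin> X" "finite X"
      using 3(2,4,5) by auto
    ultimately have "set Y = (set (c # S) \<union> found ((c, X) # t1)) - insert a (set (map fst ((c, X) # t1)))"
      unfolding t(3) by (simp, blast)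
    then show ?thesis
      using t(1,2) 3(2) by (intro exI[of _ "(c, X) # t1"] exI[of _ t2]) auto
  qed
qed auto

text \<open>The part of the stack below a waiting node does not change before that node is activated.\<close>

lemma snapshots_waiting:
  "search_trace V (X @ w # Y) t \<Longrightarrow> \<exists>W. (w, W, Y) \<in> set (snapshots (X @ w # Y) t)"
proof (induction t arbitrary: V X)
  case Nil
  then show ?case by (cases X) auto
next
  case (Cons p t)
  obtain a U where p: "p = (a, U)" by fastforce
  show ?case
  proof (cases X)
    case Nil
    then show ?thesis using Cons.prems p by auto
  next
    case (Cons b X')
    then show ?thesis
      using Cons.prems p Cons.IH[of "V \<union> U" "sorted_list_of_set U @ X'"] by auto
  qed
qed

text \<open>The batch of \<open>a\<close> is pushed on top of \<open>Y\<close>, and when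
  \<open>w\<close> is popped only its larger siblings are left above \<open>Y\<close>. Cane paths
  obey the same recursion: a turn at the parent, or a continuation from it.\<close>

lemma snapshots_child:
  "search_trace V S t \<Longrightarrow> (a, U, Y) \<in> set (snapshots S t) \<Longrightarrow>
     sorted_list_of_set U = X @ w # Z \<Longrightarrow> \<exists>W. (w, W, Z @ Y) \<in> set (snapshots S t)"
proof (induction V S t rule: search_trace.induct)
  case (3 V c S d A t)
  then show ?case
    using snapshots_waiting[of "V \<union> A" X w "Z @ S" t] by auto
qed auto

lemma sorted_list_of_set_split:
  assumes "sorted_list_of_set U = X @ w # Z" "finite U"
  shows "set Z = {u \<in> U. w < u}"
proof -
  have "sorted (X @ w # Z)" "distinct (X @ w # Z)" "U = set (X @ w # Z)"
    using assms by (metis sorted_sorted_list_of_set, metis distinct_sorted_list_of_set,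
      metis set_sorted_list_of_set)
  then show ?thesis
    by (fastforce simp: sorted_append)
qed

text \<open>Visits within a batch go by decreasing label, so the entry with index \<open>i\<close>
  has exactly \<open>i\<close> larger siblings; these and \<open>S\<close> lie below it in the stack
  when it is activated.\<close>

lemma visit_code_snapshots:
  "search_trace V S t \<Longrightarrow> (w, j) \<in> set (visit_code S t) \<Longrightarrow> \<exists>W Y. (w, W, Y) \<in> set (snapshots S t) \<and> length Y = j"
proof (induction V S t rule: search_trace.induct)
  case (3 V a S b U t)
  show ?case
  proof (cases "(w, j) \<in> set (visit_code (sorted_list_of_set U @ S) t)")
    case True
    then show ?thesis using 3 by auto
  next
    case False
    then have "(w, j) \<in> set (zip (rev (sorted_list_of_set U)) [length S..<length S + card U])"
      using 3 by auto
    then obtain i where i: "i < card U" "w = rev (sorted_list_of_set U) ! i" "j = length S + i"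
      by (auto simp: set_zip)
    let ?L = "rev (sorted_list_of_set U)"
    have "?L = take i ?L @ w # drop (Suc i) ?L"
      using i id_take_nth_drop[of i ?L] by simp
    then have *: "sorted_list_of_set U = rev (drop (Suc i) ?L) @ w # rev (take i ?L)"
      by (metis append.assoc append_Cons append_Nil rev.simps(2) rev_append rev_rev_ident)
    then have "\<exists>W. (w, W, rev (take i ?L) @ S) \<in> set (snapshots (a # S) ((b, U) # t))"
      using snapshots_child[of V "a # S" "(b, U) # t" a U S "rev (drop (Suc i) ?L)" w "rev (take i ?L)"] 3
      by auto
    moreover have "length (rev (take i ?L) @ S) = j"
      using i by auto
    ultimately show ?thesis by blast
  qed
qed auto

text \<open>For \<open>x = 2^j * y\<close> and \<open>x' = 2^j' * y'\<close> with \<open>1 < y, y' < 2\<close> this is \<open>x' \<le> 2 * x\<close>, where the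
  labels compare \<open>y\<close> and \<open>y'\<close>.\<close>

definition admissible :: "nat \<times> nat \<Rightarrow> nat \<times> nat \<Rightarrow> bool" where
  "admissible p q \<longleftrightarrow> snd q \<le> snd p \<or> (snd q = Suc (snd p) \<and> fst q < fst p)"

definition starts_below :: "nat \<Rightarrow> (nat \<times> nat) list \<Rightarrow> bool" where
  "starts_below m q \<longleftrightarrow> (q \<noteq> [] \<longrightarrow> snd (hd q) < m)"

section \<open>Which codes occur, and decoding them\<close>

lemma batch_admissible:
  assumes "finite U"
  shows "successively admissible (zip (rev (sorted_list_of_set U)) [m..<m + card U])"
proof -
  have "rev (sorted_list_of_set U) ! Suc i < rev (sorted_list_of_set U) ! i"
    if "Suc i < card U" for i
    using that assms sorted_wrt_nth_less[OF strict_sorted_list_of_set[of U],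
        of "card U - Suc (Suc i)" "card U - Suc i"]
    by (auto simp: rev_nth)
  then show ?thesis
    by (auto simp: successively_conv_nth admissible_def)
qed

text \<open>The next nonempty batch starts at the height of the stack below the popped node, and
  pops without children only shorten the stack. Hence the depth does not rise from one batch to the
  next, which makes batch boundaries visible in the code.\<close>

lemma visit_code_starts_below: "search_trace V S t \<Longrightarrow> starts_below (length S) (visit_code S t)"
proof (induction V S t rule: search_trace.induct)
  case (3 V a S b U t)
  show ?case
  proof (cases "U = {}")
    case True
    then show ?thesis using 3 by (auto simp: starts_below_def)
  next
    case False
    then have "card U > 0" using 3 by (auto simp: card_gt_0_iff)
    then have "zip (rev (sorted_list_of_set U)) [length S..<length S + card U] \<noteq> []"
      by (metis length_zip length_rev length_sorted_list_of_set length_upt add_diff_cancel_left'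
          list.size(3) min.idem less_irrefl)
    then show ?thesis using \<open>card U > 0\<close>
      by (auto simp: starts_below_def hd_append hd_conv_nth)
  qed
qed (auto simp: starts_below_def)

lemma visit_code_admissible: "search_trace V S t \<Longrightarrow> successively admissible (visit_code S t)"
proof (induction V S t rule: search_trace.induct)
  case (3 V a S b U t)
  let ?B = "zip (rev (sorted_list_of_set U)) [length S..<length S + card U]"
  have t: "search_trace (V \<union> U) (sorted_list_of_set U @ S) t" using 3 by auto
  have "admissible (last ?B) (hd (visit_code (sorted_list_of_set U @ S) t))"
    if "?B \<noteq> []" "visit_code (sorted_list_of_set U @ S) t \<noteq> []"
  proof -
    have "card U > 0" using that by (cases "card U") auto
    then have "snd (last ?B) = length S + card U - 1"
      using that by (auto simp: last_conv_nth)
    then show ?thesis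
      using visit_code_starts_below[OF t] that by (auto simp: admissible_def starts_below_def)
  qed
  moreover have "finite U" using 3 by auto
  ultimately show ?case
    using 3(1) t batch_admissible[of U "length S"]
    unfolding visit_code.simps successively_append_iff by auto
qed auto

text \<open>The code with the smaller batch would have to continue the run with depth
  \<open>m + card U\<close>, which \<open>starts_below\<close> excludes for its remainder
  \<open>r\<close>.\<close>

lemma batch_visit_code_card:
  assumes "finite U" "finite U'" "starts_below (m + card U) r" "starts_below (m + card U') r'"
    and eq: "zip (rev (sorted_list_of_set U)) [m..<m + card U] @ r =
      zip (rev (sorted_list_of_set U')) [m..<m + card U'] @ r'"
  shows "\<not> card U < card U'"
proof
  assume less: "card U < card U'"
  let ?l = "zip (rev (sorted_list_of_set U)) [m..<m + card U] @ r"
  have "snd (?l ! card U) = m + card U"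
    unfolding eq using less by (auto simp: nth_append)
  moreover have "length ?l > card U"
    unfolding eq using less by auto
  then have "r \<noteq> []" by auto
  moreover have "?l ! card U = r ! 0"
    by (auto simp: nth_append)
  ultimately show False
    using assms(3) by (auto simp: starts_below_def hd_conv_nth)
qed

lemma visit_code_inj:
  "search_trace V S t \<Longrightarrow> search_trace V S t' \<Longrightarrow> visit_code S t = visit_code S t' \<Longrightarrow> t = t'"
proof (induction V S t arbitrary: t' rule: search_trace.induct)
  case (3 V a S b U t)
  obtain U' r where t': "t' = (a, U') # r"
    using 3 by (cases t') auto
  let ?B = "\<lambda>U. zip (rev (sorted_list_of_set U)) [length S..<length S + card U]"
  have tr: "search_trace (V \<union> U) (sorted_list_of_set U @ S) t" "finite U"
    "search_trace (V \<union> U') (sorted_list_of_set U' @ S) r" "finite U'"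
    using 3 t' by auto
  have eq: "?B U @ visit_code (sorted_list_of_set U @ S) t = ?B U' @ visit_code (sorted_list_of_set U' @ S) r"
    using 3 t' by auto
  have "starts_below (length S + card U) (visit_code (sorted_list_of_set U @ S) t)"
    "starts_below (length S + card U') (visit_code (sorted_list_of_set U' @ S) r)"
    using visit_code_starts_below[OF tr(1)] visit_code_starts_below[OF tr(3)] by (auto simp: add.commute)
  then have card: "card U = card U'"
    using batch_visit_code_card eq tr(2,4) by (metis nat_neq_iff)
  then have "?B U = ?B U'" and eq2: "visit_code (sorted_list_of_set U @ S) t = visit_code (sorted_list_of_set U' @ S) r"
    using eq by auto
  then have "map fst (?B U) = map fst (?B U')" by simp
  then have "U = U'"
    using tr card by (metis length_rev length_sorted_list_of_set length_upt add_diff_cancel_left'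
      map_fst_zip rev_is_rev_conv set_sorted_list_of_set)
  then show ?case
    using 3 t' tr eq2 by auto
qed auto

text \<open>Greedy decoding of one batch. The run may be empty: if the first depth is below
  \<open>m\<close>, the active node has no children and is just popped.\<close>

lemma maximal_batch:
  assumes "successively admissible q" "starts_below (Suc m) q"
  shows "\<exists>b r. q = b @ r \<and> map snd b = [m..<m + length b] \<and> starts_below (m + length b) r"
  using assms
proof (induction q arbitrary: m)
  case Nil
  then show ?case by (auto simp: starts_below_def)
next
  case (Cons x q)
  show ?case
  proof (cases "snd x = m")
    case True
    have "starts_below (Suc (Suc m)) q"
      using Cons.prems True by (auto simp: starts_below_def successively_Cons admissible_def)
    then obtain b r where "q = b @ r" "map snd b = [Suc m..<Suc m + length b]"
      "starts_below (Suc m + length b) r"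
      using Cons by (metis successively_Cons successively.simps(1))
    then show ?thesis
      using True by (intro exI[of _ "x # b"] exI[of _ r]) (auto simp: upt_rec[of m])
  next
    case False
    then show ?thesis
      using Cons.prems by (intro exI[of _ "[]"] exI[of _ "x # q"]) (auto simp: starts_below_def)
  qed
qed

lemma visit_code_surj:
  "successively admissible q \<Longrightarrow> starts_below (length S) q \<Longrightarrow> distinct (map fst q) \<Longrightarrow>
     set (map fst q) \<inter> V = {} \<Longrightarrow> \<exists>t. search_trace V S t \<and> visit_code S t = q"
\<comment> \<open>Decoding a batch moves its entries from the code to the stack and pops one node,
  so a code entry has to weigh more than a stack entry.\<close>
proof (induction "2 * length q + length S" arbitrary: V S q rule: less_induct)
  case less
  show ?case
  proof (cases S)
    case Nil
    then show ?thesis using less.prems by (auto simp: starts_below_def)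
  next
    case (Cons a S0)
    obtain b r where q: "q = b @ r" "map snd b = [length S0..<length S0 + length b]"
      "starts_below (length S0 + length b) r"
      using maximal_batch[of q "length S0"] less.prems Cons by auto
    let ?U = "set (map fst b)"
    \<comment> \<open>Inside a run the depth rises by one, so \<open>admissible\<close> forces the
      labels to decrease; the run is therefore the reversed sorted list of its label set.\<close>
    have "fst (b ! Suc i) < fst (b ! i)" if "Suc i < length b" for i
    proof -
      have "successively admissible b"
        using less.prems(1) q(1) by (simp add: successively_append_iff)
      then have "admissible (b ! i) (b ! Suc i)"
        using that by (simp add: successively_conv_nth)
      moreover have "snd (b ! i) = length S0 + i" "snd (b ! Suc i) = length S0 + Suc i"
        using q(2) that by (metis nth_map nth_upt Suc_lessD nat_add_left_cancel_less)+
      ultimately show ?thesis by (auto simp: admissible_def)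
    qed
    then have "successively (\<lambda>x y. y < x) (map fst b)"
      by (auto simp: successively_conv_nth)
    then have "sorted_wrt (\<lambda>x y. y < x) (map fst b)"
      by (subst (asm) successively_conv_sorted_wrt) (auto simp: transp_def)
    then have "sorted_wrt (<) (rev (map fst b))"
      by (simp add: sorted_wrt_rev)
    then have "sorted_list_of_set ?U = rev (map fst b)"
      using sorted_list_of_set.idem_if_sorted_distinct[of "rev (map fst b)"]
      by (simp add: strict_sorted_iff)
    then have sl: "rev (sorted_list_of_set ?U) = map fst b"
      by simp
    have cU: "card ?U = length b"
      using less.prems(3) q by (metis distinct_append distinct_card length_map map_append)
    have B: "zip (rev (sorted_list_of_set ?U)) [length S0..<length S0 + card ?U] = b"
      unfolding sl cU q(2)[symmetric] by (rule zip_map_fst_snd)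
    have "2 * length r + length (sorted_list_of_set ?U @ S0) < 2 * length q + length S"
      using q(1) Cons cU by auto
    then obtain t where "search_trace (V \<union> ?U) (sorted_list_of_set ?U @ S0) t"
      "visit_code (sorted_list_of_set ?U @ S0) t = r"
      using less.hyps[of r "sorted_list_of_set ?U @ S0" "V \<union> ?U"] less.prems q cU
      by (auto simp: successively_append_iff add.commute)
    then show ?thesis
      using Cons B less.prems q
      by (intro exI[of _ "(a, ?U) # t"]) auto
  qed
qed


section \<open>Traces of graphs and trees\<close>

lemma nfs_step_stack:
  fixes vs :: "nat list" and S :: "nat list"
  assumes U: "U = new (set vs) a" "finite U" "U \<inter> set vs = {}"
    and BA: "BA \<subseteq> set vs" and S: "filter (\<lambda>v. v \<notin> BA) vs = rev S"
  defines "nx \<equiv> (case sorted_list_of_set U @ S of [] \<Rightarrow> None | b # _ \<Rightarrow> Some b)"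
  shows "nfs_step new \<lparr>visited = vs, been_active = BA, active = Some a, search_edges = E\<rparr> =
    \<lparr>visited = vs @ rev (sorted_list_of_set U), been_active = BA \<union> set_option nx,
     active = nx, search_edges = E \<union> (\<lambda>u. {a, u}) ` U\<rparr>"
proof -
  let ?vs = "vs @ rev (sorted_list_of_set U)"
  let ?w = "filter (\<lambda>v. v \<notin> BA) ?vs"
  have "filter (\<lambda>v. v \<notin> BA) (rev (sorted_list_of_set U)) = rev (sorted_list_of_set U)"
    using U BA by (intro filter_True) auto
  then have "?w = rev (sorted_list_of_set U @ S)"
    using S by simp
  moreover have "sorted_list_of_set U = Min U # sorted_list_of_set (U - {Min U})" if "U \<noteq> {}"
    using that U(2) by (simp add: sorted_list_of_set_nonempty)
  ultimately have nx: "(if U \<noteq> {} then Some (Min U) else if ?w \<noteq> [] then Some (last ?w) else None) = nx"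
  proof (cases "U = {}")
    case True
    then show ?thesis
      unfolding \<open>?w = rev (sorted_list_of_set U @ S)\<close> nx_def by (cases S) auto
  next
    case False
    then show ?thesis
      unfolding nx_def using \<open>U \<noteq> {} \<Longrightarrow> sorted_list_of_set U = Min U # sorted_list_of_set (U - {Min U})\<close>
      by simp
  qed
  show ?thesis
    unfolding nfs_step_def Let_def nfs_state.simps option.sel U(1)[symmetric] nx ..
qed

text \<open>Invariant: the visited nodes that have not been active, in the order of visits, are the
  stack read from bottom to top. Each trace entry unfolds the loop once, so induction over the trace
  also settles termination.\<close>

lemma nfs_loop:
  assumes "search_trace (set vs) (a # S) t" "follows new (set vs) t" "distinct vs"
    "BA \<subseteq> set vs" "filter (\<lambda>v. v \<notin> BA) vs = rev S"
  shows "\<exists>BA'. while (\<lambda>s. active s \<noteq> None) (nfs_step new)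
      \<lparr>visited = vs, been_active = BA, active = Some a, search_edges = E\<rparr> =
      \<lparr>visited = vs @ visit_list t, been_active = BA', active = None,
       search_edges = E \<union> trace_edges t\<rparr>"
  using assms
proof (induction t arbitrary: vs a S BA E)
  case Nil
  then show ?case by simp
next
  case (Cons p t)
  obtain U where p: "p = (a, U)" using Cons.prems(1) by (cases p) auto
  have U: "U = new (set vs) a" "finite U" "U \<inter> set vs = {}"
    and t: "search_trace (set vs \<union> U) (sorted_list_of_set U @ S) t" "follows new (set vs \<union> U) t"
    using Cons.prems p by auto
  let ?vs = "vs @ rev (sorted_list_of_set U)"
  have vs: "set ?vs = set vs \<union> U" "distinct ?vs" using U Cons.prems by auto
  note step = nfs_step_stack[where new = new, OF U Cons.prems(4,5), of E]
  have "filter (\<lambda>v. v \<notin> BA) (rev (sorted_list_of_set U)) = rev (sorted_list_of_set U)"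
    using U Cons.prems(4) by (intro filter_True) auto
  then have w: "filter (\<lambda>v. v \<notin> BA) ?vs = rev (sorted_list_of_set U @ S)"
    using Cons.prems(5) by simp
  show ?case
  proof (cases "sorted_list_of_set U @ S")
    case Nil
    then have "t = []" using t by simp
    \<comment> \<open>One unfolding performs the last step, the other sees that no node is active
      and stops.\<close>
    then show ?thesis
      using Nil step p by (subst while_unfold, subst while_unfold) simp
  next
    case (Cons b S')
    have "distinct (b # S')"
      using w vs(2) Cons by (metis distinct_filter distinct_rev)
    have "filter (\<lambda>v. v \<notin> BA \<union> {b}) ?vs = filter (\<lambda>v. v \<noteq> b) (filter (\<lambda>v. v \<notin> BA) ?vs)"
      by (simp add: filter_filter conj_commute)
    also have "\<dots> = rev S'"
      unfolding w Cons using \<open>distinct (b # S')\<close> by (auto intro!: filter_True)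
    finally have f: "filter (\<lambda>v. v \<notin> BA \<union> {b}) ?vs = rev S'" .
    have "b \<in> set ?vs"
      using w Cons by (metis filter_is_subset in_set_conv_decomp set_rev subsetD append_Nil)
    then have "BA \<union> {b} \<subseteq> set ?vs" using Cons.prems(4) by auto
    then obtain BA' where "while (\<lambda>s. active s \<noteq> None) (nfs_step new)
      \<lparr>visited = ?vs, been_active = BA \<union> {b}, active = Some b, search_edges = E \<union> (\<lambda>u. {a, u}) ` U\<rparr> =
      \<lparr>visited = ?vs @ visit_list t, been_active = BA', active = None,
       search_edges = E \<union> (\<lambda>u. {a, u}) ` U \<union> trace_edges t\<rparr>"
      using Cons.IH[of ?vs b S' "BA \<union> {b}" "E \<union> (\<lambda>u. {a, u}) ` U"] t vs f Cons by metis
    then show ?thesis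
      using Cons step p by (subst while_unfold) (simp add: Un_assoc)
  qed
qed

lemma nfs_component_trace:
  assumes "search_trace {r} [r] t" "follows new {r} t"
  shows "visited (nfs_component new r) = r # visit_list t"
    and "search_edges (nfs_component new r) = trace_edges t"
  using nfs_loop[of "[r]" r "[]" t new "{r}" "{}"] assms
  by (auto simp: nfs_component_def nfs_init_def)

lemma follows_unique:
  "search_trace V S t \<Longrightarrow> follows new V t \<Longrightarrow> search_trace V S t' \<Longrightarrow> follows new V t' \<Longrightarrow> t = t'"
proof (induction V S t arbitrary: t' rule: search_trace.induct)
  case (3 V a S b U t)
  have "b = a" using 3(2) by simp
  obtain U' r where t': "t' = (a, U') # r" using 3(4) by (cases t') auto
  have "U' = U" using 3(3) 3(5)[unfolded t'] \<open>b = a\<close> by simp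
  then have "t = r" using 3(2-5) t' by (intro 3(1)) auto
  then show ?case using t' \<open>U' = U\<close> \<open>b = a\<close> by simp
qed auto

lemma follows_const: "(\<And>a U. (a, U) \<in> set t \<Longrightarrow> U = f a) \<Longrightarrow> follows (\<lambda>_. f) V t"
  by (induction t arbitrary: V) auto

lemma follows_append: "follows new V (t1 @ t2) \<longleftrightarrow> follows new V t1 \<and> follows new (V \<union> found t1) t2"
  by (induction t1 arbitrary: V) (auto simp: Un_assoc)

lemma search_trace_exists:
  assumes "finite A" and "\<And>V a. new V a \<subseteq> A - V" and "V \<subseteq> A"
  shows "\<exists>t. search_trace V S t \<and> follows new V t \<and> found t \<subseteq> A"
  using assms(3)
proof (induction "2 * card (A - V) + length S" arbitrary: V S rule: less_induct)
  case less
  show ?case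
  proof (cases S)
    case Nil
    then show ?thesis by (intro exI[of _ "[]"]) auto
  next
    case (Cons a S0)
    let ?U = "new V a"
    have U: "?U \<subseteq> A - V" "finite ?U" using assms finite_subset by blast+
    have "card (A - (V \<union> ?U)) = card (A - V) - card ?U"
      using U by (subst Un_commute) (metis Diff_Un Diff_Int2 card_Diff_subset set_diff_eq Diff_eq Int_assoc Int_commute compl_sup)
    moreover have "card ?U \<le> card (A - V)"
      using U assms(1) by (meson card_mono finite_Diff)
    ultimately have "2 * card (A - (V \<union> ?U)) + length (sorted_list_of_set ?U @ S0)
        < 2 * card (A - V) + length S"
      using Cons by simp
    then obtain t where "search_trace (V \<union> ?U) (sorted_list_of_set ?U @ S0) t"
      "follows new (V \<union> ?U) t" "found t \<subseteq> A"
      using less.hyps[of "V \<union> ?U" "sorted_list_of_set ?U @ S0"] less.prems U by auto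
    then show ?thesis
      using Cons U by (intro exI[of _ "(a, ?U) # t"]) auto
  qed
qed

section \<open>The trace of a connected graph\<close>

definition unvisited_nbrs :: "lgraph \<Rightarrow> nat set \<Rightarrow> nat \<Rightarrow> nat set" where
  "unvisited_nbrs G V a = {u. adjacent G a u \<and> u \<notin> V}"

text \<open>A connected graph has a single component with root \<open>N\<close>, its largest label,
  so the search starts with \<open>N\<close> visited and alone on the stack.\<close>

definition full_trace :: "nat \<Rightarrow> trace \<Rightarrow> bool" where
  "full_trace N t \<longleftrightarrow> 1 \<le> N \<and> search_trace {N} [N] t \<and> insert N (found t) = {1..N}"

text \<open>A neighbour of the active node is already visited or joins the batch. As all visited
  nodes become active, the visited set is closed under adjacency, and connectedness then makes it
  all of \<open>{1..N}\<close>.\<close>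

lemma follows_nbrs_found:
  "follows (unvisited_nbrs G) V t \<Longrightarrow> (a, U) \<in> set t \<Longrightarrow> adjacent G a u \<Longrightarrow> u \<in> V \<union> found t"
proof (induction t arbitrary: V)
  case (Cons p t)
  obtain b W where p: "p = (b, W)" by fastforce
  show ?case
  proof (cases "(a, U) = p")
    case True
    then show ?thesis using Cons.prems p by (auto simp: unvisited_nbrs_def)
  next
    case False
    then show ?thesis using Cons.IH[of "V \<union> W"] Cons.prems p by auto
  qed
qed auto

lemma labeled_graph_adjacent:
  assumes "labeled_graph N G" "adjacent G a u"
  shows "a \<in> {1..N}" "u \<in> {1..N}" "a \<noteq> u"
  using assms unfolding labeled_graph_def by (fastforce simp: doubleton_eq_iff)+

lemma full_trace_exists:
  assumes G: "labeled_graph N G" "lg_connected N G" and N: "1 \<le> N"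
  shows "\<exists>t. full_trace N t \<and> follows (unvisited_nbrs G) {N} t"
proof -
  have "unvisited_nbrs G V a \<subseteq> {1..N} - V" for V a
    using labeled_graph_adjacent[OF G(1)] by (auto simp: unvisited_nbrs_def)
  then obtain t where t: "search_trace {N} [N] t" "follows (unvisited_nbrs G) {N} t" "found t \<subseteq> {1..N}"
    using search_trace_exists[of "{1..N}" "unvisited_nbrs G" "{N}" "[N]"] N by auto
  have activated: "fst ` set t = insert N (found t)"
    using search_trace_activated[OF t(1)] by auto
  have "v \<in> insert N (found t)" if "(adjacent G)\<^sup>*\<^sup>* N v" for v
    using that
  proof induction
    case (step y z)
    then obtain U where "(y, U) \<in> set t" using activated by force
    then show ?case using follows_nbrs_found[OF t(2)] step by auto
  qed auto
  then have "insert N (found t) = {1..N}"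
    using G(2) N t(3) by (fastforce simp: lg_connected_def)
  then show ?thesis
    using t N by (auto simp: full_trace_def)
qed

lemma lg_root_connected:
  assumes "lg_connected N G" "v \<in> {1..N}"
  shows "lg_root N G v = N"
proof -
  have "lg_component N G v = {1..N}"
    using assms by (auto simp: lg_component_def lg_connected_def)
  then show ?thesis
    using assms(2) unfolding lg_root_def by (simp only:) (rule Max_eqI, auto)
qed

lemma nfs_roots_connected:
  assumes "lg_connected N G" "1 \<le> N"
  shows "nfs_roots N G = [N]"
proof -
  have "lg_root N G ` {1..N} = {N}"
    using assms lg_root_connected[OF assms(1)] by (auto intro!: image_eqI[of N _ N])
  then show ?thesis by (simp add: nfs_roots_def)
qed

lemma nfs_forest_trace:
  assumes "lg_connected N G" "full_trace N t" "follows (unvisited_nbrs G) {N} t"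
  shows "nfs_forest N G = trace_edges t"
  using assms nfs_component_trace(2)[of N t "unvisited_nbrs G"]
  by (simp add: nfs_forest_def nfs_roots_connected full_trace_def unvisited_nbrs_def[abs_def])

section \<open>The search tree of a trace\<close>

definition child_arc :: "trace \<Rightarrow> nat \<Rightarrow> nat \<Rightarrow> bool" where
  "child_arc t a u \<longleftrightarrow> (\<exists>U. (a, U) \<in> set t \<and> u \<in> U)"

text \<open>The time at which \<open>v\<close> becomes active, or \<open>length t\<close> if it
  never does. Edges are oriented by comparing these times.\<close>

definition activation :: "trace \<Rightarrow> nat \<Rightarrow> nat" where
  "activation t v = length (takeWhile (\<lambda>(b, _). b \<noteq> v) t)"

lemma adjacent_trace_edges: "adjacent (trace_edges t) x y \<longleftrightarrow> child_arc t x y \<or> child_arc t y x"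
  unfolding trace_edges_def child_arc_def by (auto simp: doubleton_eq_iff)

lemma activation_append:
  assumes "a \<notin> fst ` set t1"
  shows "activation (t1 @ (a, U) # t2) a = length t1"
    and "w \<notin> insert a (fst ` set t1) \<Longrightarrow> length t1 < activation (t1 @ (a, U) # t2) w"
proof -
  show "activation (t1 @ (a, U) # t2) a = length t1"
    using assms by (subst activation_def, subst takeWhile_append2) force+
  assume "w \<notin> insert a (fst ` set t1)"
  then show "length t1 < activation (t1 @ (a, U) # t2) w"
    by (subst activation_def, subst takeWhile_append2) force+
qed

lemma path_rtranclp: "lg_path G p \<Longrightarrow> (adjacent G)\<^sup>*\<^sup>* (hd p) (last p)"
proof (induction p)
  case (Cons a p)
  then show ?case
    by (cases p) (auto simp: lg_path_def intro: converse_rtranclp_into_rtranclp)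
qed (simp add: lg_path_def)

context
  fixes N t assumes full: "full_trace N t"
begin

lemma full_trace_search: "search_trace {N} [N] t"
  using full by (simp add: full_trace_def)

lemma full_trace_activated: "distinct (map fst t)" "fst ` set t = {1..N}"
  using search_trace_activated[OF full_trace_search] full by (auto simp: full_trace_def)

lemma found_full_trace: "found t = {1..N} - {N}"
  using full search_trace_found_fresh[OF full_trace_search] by (auto simp: full_trace_def)

lemma full_trace_split:
  assumes "t = t1 @ (a, U) # t2"
  shows "a \<notin> fst ` set t1" "fst ` set t1 \<subseteq> insert N (found t1)"
    "a \<in> insert N (found t1)" "U \<inter> insert N (found t1) = {}"
proof -
  show "a \<notin> fst ` set t1" using full_trace_activated(1) assms by auto
  obtain S' where S': "search_trace (insert N (found t1)) S' ((a, U) # t2)"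
      "set S' = insert N (found t1) - fst ` set t1"
    using search_trace_append[of "{N}" "[N]" t1 "(a, U) # t2"] full_trace_search assms by auto
  then have "a \<in> set S'" "U \<inter> insert N (found t1) = {}"
    by (cases S'; auto)+
  then show "a \<in> insert N (found t1)" "U \<inter> insert N (found t1) = {}" using S' by auto
  show "fst ` set t1 \<subseteq> insert N (found t1)"
  proof
    fix b assume "b \<in> fst ` set t1"
    then obtain W where "(b, W) \<in> set t1" by auto
    then obtain s1 s2 where s: "t1 = s1 @ (b, W) # s2" by (metis split_list)
    then obtain S'' where "search_trace (insert N (found s1)) S'' ((b, W) # s2 @ (a, U) # t2)"
      "set S'' = insert N (found s1) - fst ` set s1"
      using search_trace_append[of "{N}" "[N]" s1 "(b, W) # s2 @ (a, U) # t2"] full_trace_search assms by auto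
    then have "b \<in> insert N (found s1)" by (cases S'') auto
    then show "b \<in> insert N (found t1)" using s by auto
  qed
qed

lemma child_arc_activation: "child_arc t a u \<Longrightarrow> activation t a < activation t u"
proof -
  assume "child_arc t a u"
  then obtain U t1 t2 where "u \<in> U" and t: "t = t1 @ (a, U) # t2"
    unfolding child_arc_def by (metis split_list)
  moreover note full_trace_split[OF t]
  ultimately have "u \<notin> insert a (fst ` set t1)" "a \<notin> fst ` set t1" by auto
  then show ?thesis
    using activation_append(1)[of a t1 U t2] activation_append(2)[of a t1 u U t2] t by metis
qed

lemma child_arc_nodes: "child_arc t a u \<Longrightarrow> a \<in> {1..N} \<and> u \<in> {1..N} \<and> u \<noteq> N \<and> a \<noteq> u"
proof -
  assume a: "child_arc t a u"
  then obtain U where U: "(a, U) \<in> set t" "u \<in> U" by (auto simp: child_arc_def)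
  then have "u \<in> found t" unfolding found_def by force
  moreover have "a \<in> {1..N}" using U full_trace_activated(2) by force
  ultimately show ?thesis
    using found_full_trace child_arc_activation[OF a] by auto
qed

lemma child_arc_parent: "child_arc t a u \<Longrightarrow> child_arc t b u \<Longrightarrow> a = b"
  using search_trace_parent_unique[OF full_trace_search] by (auto simp: child_arc_def)

lemma parent_exists: "u \<in> {1..N} \<Longrightarrow> u \<noteq> N \<Longrightarrow> \<exists>a. child_arc t a u"
proof -
  assume "u \<in> {1..N}" "u \<noteq> N"
  then have "u \<in> found t" using found_full_trace by simp
  then show ?thesis unfolding found_def child_arc_def by force
qed

lemma trace_edges_labeled_graph: "labeled_graph N (trace_edges t)"
  unfolding labeled_graph_def
proof
  fix E assume "E \<in> trace_edges t"
  then obtain a u where "E = {a, u}" "child_arc t a u" by (auto simp: trace_edges_def child_arc_def)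
  then show "\<exists>u v. E = {u, v} \<and> u \<in> {1..N} \<and> v \<in> {1..N} \<and> u \<noteq> v"
    using child_arc_nodes by blast
qed

text \<open>The bound on activation times shows that the appended node \<open>w\<close> is new, so
  the sequence of ancestors stays a path.\<close>

lemma root_path:
  "w \<in> {1..N} \<Longrightarrow> \<exists>p. lg_path (trace_edges t) p \<and> hd p = N \<and> last p = w \<and>
     (\<forall>x\<in>set p. activation t x \<le> activation t w)"
proof (induction "activation t w" arbitrary: w rule: less_induct)
  case less
  show ?case
  proof (cases "w = N")
    case True
    then show ?thesis by (intro exI[of _ "[N]"]) (auto simp: lg_path_def)
  next
    case False
    then obtain v where v: "child_arc t v w" using parent_exists[of w] less.prems by blast
    then obtain p where p: "lg_path (trace_edges t) p" "hd p = N" "last p = v"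
      "\<forall>x\<in>set p. activation t x \<le> activation t v"
      using less child_arc_activation child_arc_nodes by metis
    then have "lg_path (trace_edges t) (p @ [w])"
      using v child_arc_activation[OF v]
      by (auto simp: lg_path_def successively_append_iff adjacent_trace_edges)
    then show ?thesis
      using p child_arc_activation[OF v]
      by (intro exI[of _ "p @ [w]"]) (auto simp: lg_path_def)
  qed
qed

lemma trace_edges_connected: "lg_connected N (trace_edges t)"
proof -
  have *: "(adjacent (trace_edges t))\<^sup>*\<^sup>* N v" if "v \<in> {1..N}" for v
    using root_path[OF that] path_rtranclp by metis
  have "symp (adjacent (trace_edges t))" by (auto simp: symp_def insert_commute)
  then have "symp (adjacent (trace_edges t))\<^sup>*\<^sup>*" by (rule symp_rtranclp)
  then show ?thesis
    unfolding lg_connected_def using * by (blast dest: sympD intro: rtranclp_trans)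
qed

text \<open>On a cycle, the node activated last would have two different neighbours that are both
  its parent.\<close>

lemma trace_edges_acyclic: "\<not> lg_cycle (trace_edges t) p"
proof
  assume c: "lg_cycle (trace_edges t) p"
  let ?T = "trace_edges t" and ?n = "length p"
  have p: "distinct p" "3 \<le> ?n" "successively (adjacent ?T) p" "adjacent ?T (last p) (hd p)" "p \<noteq> []"
    using c by (auto simp: lg_cycle_def lg_path_def)
  have nxt: "adjacent ?T (p ! i) (p ! (Suc i mod ?n))" if "i < ?n" for i
  proof (cases "Suc i < ?n")
    case True
    then show ?thesis using p(3) by (simp add: successively_conv_nth)
  next
    case False
    then have "i = ?n - 1" "Suc i = ?n" using that by auto
    then show ?thesis using p by (simp add: last_conv_nth hd_conv_nth)
  qed
  obtain x where x: "x \<in> set p" "\<forall>y\<in>set p. activation t y \<le> activation t x"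
  proof -
    have "Max (activation t ` set p) \<in> activation t ` set p" using p(5) by (intro Max_in) auto
    then obtain x where "x \<in> set p" "activation t x = Max (activation t ` set p)" by auto
    then show ?thesis using that[of x] by simp
  qed
  obtain i where i: "i < ?n" "x = p ! i" using x(1) by (metis in_set_conv_nth)
  have up: "child_arc t y x" if "y \<in> set p" "adjacent ?T x y" for y
    using that x(2) child_arc_activation by (fastforce simp: adjacent_trace_edges)
  let ?s = "Suc i mod ?n"
  define k where "k = (if i = 0 then ?n - 1 else i - 1)"
  have k: "k < ?n" "Suc k mod ?n = i" using i p(2) by (auto simp: k_def)
  have s: "?s < ?n" using p(2) by (intro mod_less_divisor) linarith
  \<comment> \<open>Here the cycle needs at least three nodes: with two, the predecessor
    \<open>k\<close> and the successor \<open>?s\<close> of \<open>i\<close> would coincide.\<close>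
  have "k \<noteq> ?s" using i p(2) by (auto simp: k_def mod_Suc split: if_splits)
  then have "p ! k \<noteq> p ! ?s" using p(1) k s by (simp add: nth_eq_iff_index_eq)
  moreover have "child_arc t (p ! ?s) x" using up[of "p ! ?s"] nxt[OF i(1)] i s by auto
  moreover have "child_arc t (p ! k) x" using up[of "p ! k"] nxt[OF k(1)] i k by (auto simp: insert_commute)
  ultimately show False using child_arc_parent by blast
qed

lemma trace_edges_tree: "labeled_tree N (trace_edges t)"
  unfolding labeled_tree_def
  using trace_edges_labeled_graph trace_edges_connected trace_edges_acyclic by blast

text \<open>A path from the root can only descend: \<open>N\<close> has no parent, and a step up
  from \<open>v\<close> would lead back to the node \<open>x\<close> it came from. This identifies
  \<open>children\<close>, defined by paths, with the arcs of the trace.\<close>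

lemma path_child_arc:
  "lg_path (trace_edges t) (p @ [v, w]) \<Longrightarrow> hd (p @ [v, w]) = N \<Longrightarrow> child_arc t v w"
proof (induction p arbitrary: v w rule: rev_induct)
  case Nil
  then show ?case using child_arc_nodes by (auto simp: lg_path_def adjacent_trace_edges)
next
  case (snoc x p)
  have "lg_path (trace_edges t) (p @ [x, v])" "adjacent (trace_edges t) v w" "w \<noteq> x"
    using snoc.prems(1) by (auto simp: lg_path_def successively_append_iff)
  moreover have "hd (p @ [x, v]) = N" using snoc.prems(2) by (cases p) auto
  ultimately have "child_arc t x v" using snoc.IH by blast
  then show ?case
    using \<open>adjacent (trace_edges t) v w\<close> \<open>w \<noteq> x\<close> child_arc_parent by (auto simp: adjacent_trace_edges)
qed

lemma children_child_arc: "children N (trace_edges t) v = {w. child_arc t v w}"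
proof -
  have "w \<in> children N (trace_edges t) v" if vw: "child_arc t v w" for w
  proof -
    obtain p where p: "lg_path (trace_edges t) p" "hd p = N" "last p = v"
      "\<forall>x\<in>set p. activation t x \<le> activation t v"
      using root_path[of v] child_arc_nodes[OF vw] by blast
    then obtain p' where p': "p = p' @ [v]"
      by (metis append_butlast_last_id lg_path_def)
    have "lg_path (trace_edges t) (p @ [w])"
      using vw p child_arc_activation[OF vw]
      by (auto simp: lg_path_def successively_append_iff adjacent_trace_edges)
    moreover have "hd (p @ [w]) = lg_root N (trace_edges t) w"
      using p child_arc_nodes[OF vw] lg_root_connected[OF trace_edges_connected] by (auto simp: lg_path_def)
    ultimately show ?thesis
      unfolding children_def using p' child_arc_nodes[OF vw] by (auto intro!: exI[of _ p'])
  qed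
  moreover have "child_arc t v w" if "w \<in> children N (trace_edges t) v" for w
    using that path_child_arc lg_root_connected[OF trace_edges_connected]
    by (auto simp: children_def)
  ultimately show ?thesis by blast
qed

lemma children_trace: "(a, U) \<in> set t \<Longrightarrow> children N (trace_edges t) a = U"
  unfolding children_child_arc child_arc_def using full_trace_activated(1) by (auto dest: eq_key_imp_eq_value)

text \<open>Searching the tree by its own rule reproduces the trace that defined its edges. So NFS
  positions can be read off from \<open>t\<close>, and the edges determine \<open>t\<close>.\<close>

lemma follows_children: "follows (\<lambda>_ a. children N (trace_edges t) a) {N} t"
  by (rule follows_const) (simp add: children_trace)

lemma nfs_order_trace: "nfs_order N (trace_edges t) = N # visit_list t"
  using full nfs_component_trace(1)[OF full_trace_search follows_children]
  by (simp add: nfs_order_def nfs_roots_connected trace_edges_connected full_trace_def)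

end

lemma full_trace_unique:
  assumes "full_trace N t" "full_trace N t'" "trace_edges t = trace_edges t'"
  shows "t = t'"
  using follows_unique[of "{N}" "[N]" t _ t'] assms follows_children
  by (metis full_trace_def)

lemma rtranclp_path:
  assumes "(adjacent G)\<^sup>*\<^sup>* u v"
  shows "\<exists>p. lg_path G p \<and> hd p = u \<and> last p = v"
  using assms
proof induction
  case base
  then show ?case by (intro exI[of _ "[u]"]) (auto simp: lg_path_def)
next
  case (step y z)
  then obtain p where p: "lg_path G p" "hd p = u" "last p = y" by auto
  show ?case
  proof (cases "z \<in> set p")
    case True
    then obtain a b where "p = a @ z # b" by (metis split_list)
    then show ?thesis
      using p by (intro exI[of _ "a @ [z]"])
        (auto simp: lg_path_def successively_append_iff successively_Cons hd_append)
  next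
    case False
    then show ?thesis
      using p step by (intro exI[of _ "p @ [z]"]) (auto simp: lg_path_def successively_append_iff)
  qed
qed

text \<open>An edge of \<open>T\<close> missing from \<open>T'\<close> would close a cycle with the
  path in \<open>T'\<close> between its ends.\<close>

lemma spanning_subtree_eq:
  assumes "labeled_tree N T" "T' \<subseteq> T" "lg_connected N T'"
  shows "T' = T"
proof (rule ccontr)
  assume "T' \<noteq> T"
  then obtain E where E: "E \<in> T" "E \<notin> T'" using assms by auto
  then obtain u v where uv: "E = {u, v}" "u \<in> {1..N}" "v \<in> {1..N}" "u \<noteq> v"
    using assms by (auto simp: labeled_tree_def labeled_graph_def)
  then obtain p where p: "lg_path T' p" "hd p = u" "last p = v"
    using assms rtranclp_path by (metis lg_connected_def)
  have "3 \<le> length p"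
  proof (rule ccontr)
    assume "\<not> 3 \<le> length p"
    then have "length p = 1 \<or> length p = 2"
      using p by (cases "length p") (auto simp: lg_path_def)
    then have "p = [u] \<or> p = [u, v]"
      using p by (auto simp: length_Suc_conv numeral_2_eq_2)
    then show False using p uv E by (elim disjE) (simp_all add: lg_path_def)
  qed
  moreover have "lg_path T p"
    using p assms by (auto simp: lg_path_def elim!: successively_mono)
  moreover have "adjacent T (last p) (hd p)" using p uv E by (simp add: insert_commute)
  ultimately show False using assms by (auto simp: labeled_tree_def lg_cycle_def)
qed

lemma follows_nbrs_subset: "follows (unvisited_nbrs G) V t \<Longrightarrow> trace_edges t \<subseteq> G"
proof (induction t arbitrary: V)
  case (Cons p t)
  obtain a U where p: "p = (a, U)" by fastforce
  have "trace_edges t \<subseteq> G" using Cons.IH[of "V \<union> U"] Cons.prems unfolding p follows.simps by blast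
  moreover have "U = unvisited_nbrs G V a" using Cons.prems p by simp
  then have "(\<lambda>u. {a, u}) ` U \<subseteq> G" by (auto simp: unvisited_nbrs_def)
  ultimately show ?case using p by simp
qed auto

text \<open>Searching \<open>T\<close> as a graph yields a connected subgraph on all nodes, which
  must be \<open>T\<close> itself.\<close>

lemma tree_trace_exists:
  assumes "labeled_tree N T" "1 \<le> N"
  shows "\<exists>t. full_trace N t \<and> trace_edges t = T"
proof -
  obtain t where t: "full_trace N t" "follows (unvisited_nbrs T) {N} t"
    using full_trace_exists[of N T] assms unfolding labeled_tree_def by blast
  then show ?thesis
    using spanning_subtree_eq[OF assms(1)] follows_nbrs_subset trace_edges_connected by metis
qed


section \<open>Cane paths and the fibers of the search\<close>

text \<open>The edges that can be added freely to the tree: an active node joined to a node waiting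
  at that moment. They turn out to be the pairs of end points of cane paths.\<close>

definition cane_edges :: "nat \<Rightarrow> trace \<Rightarrow> lgraph" where
  "cane_edges N t = {{a, w} | a U Y w. (a, U, Y) \<in> set (snapshots [N] t) \<and> w \<in> set Y}"

lemma activation_mem:
  assumes "v \<in> fst ` set t1"
  shows "activation (t1 @ t2) v < length t1"
proof -
  have "takeWhile (\<lambda>(b, _). b \<noteq> v) (t1 @ t2) = takeWhile (\<lambda>(b, _). b \<noteq> v) t1"
    using assms by (auto intro: takeWhile_append1)
  moreover have "length (takeWhile (\<lambda>(b, _). b \<noteq> v) t1) < length t1"
    using assms by (metis (mono_tags, lifting) case_prodE fst_conv imageE length_takeWhile_le
        order_le_neq_trans prod.collapse set_takeWhileD takeWhile_eq_all_conv takeWhile_eq_take take_all_iff order_refl)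
  ultimately show ?thesis by (simp add: activation_def)
qed

lemma follows_splitI:
  "(\<And>t1 a U t2. t = t1 @ (a, U) # t2 \<Longrightarrow> U = new (V \<union> found t1) a) \<Longrightarrow> follows new V t"
proof (induction t arbitrary: V)
  case (Cons p t)
  obtain a U where p: "p = (a, U)" by fastforce
  have "follows new (V \<union> U) t"
  proof (rule Cons.IH)
    fix t1 b W t2 assume "t = t1 @ (b, W) # t2"
    then show "W = new (V \<union> U \<union> found t1) b"
      using Cons.prems[of "p # t1" b W t2] p by (simp add: Un_assoc)
  qed
  then show ?case
    using Cons.prems[of "[]" a U t] p by simp
qed auto

text \<open>Replaces the definition by indices in inductions along the ancestors: a cane path turns
  down at the parent at once or goes on as a cane path from the parent.\<close>

lemma cane_path_Cons:
  "cane_path N F (v # p) \<longleftrightarrow>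
     (\<exists>a w. p = [a, w] \<and> v \<in> children N F a \<and> w \<in> children N F a \<and> v < w) \<or>
     (v \<in> children N F (hd p) \<and> cane_path N F p)"
proof (cases "length p \<le> 2")
  case True
  then have "\<not> cane_path N F p" by (auto simp: cane_path_def)
  moreover have "cane_path N F (v # p) \<longleftrightarrow> length p = 2 \<and> v \<in> children N F (p ! 0) \<and>
      p ! 1 \<in> children N F (p ! 0) \<and> v < p ! 1"
    using True by (auto simp: cane_path_def)
  moreover have "length p = 2 \<longleftrightarrow> (\<exists>a w. p = [a, w])"
    by (auto simp: length_Suc_conv numeral_2_eq_2)
  ultimately show ?thesis by auto
next
  case False
  then obtain k where k: "length p = k + 1" "k \<ge> 2" "p \<noteq> []"
    by (metis One_nat_def Suc_1 Suc_eq_plus1 Suc_le_mono linorder_not_le list.size(3) not_less_eq_eq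
        not0_implies_Suc zero_le nle_le)
  have "(\<forall>i<Suc k - 1. (v # p) ! i \<in> children N F ((v # p) ! (i + 1))) \<longleftrightarrow>
      v \<in> children N F (hd p) \<and> (\<forall>i<k - 1. p ! i \<in> children N F (p ! (i + 1)))"
    using k by (cases k) (auto simp: All_less_Suc2 hd_conv_nth)
  moreover have "cane_path N F (v # p) \<longleftrightarrow> (\<forall>i<Suc k - 1. (v # p) ! i \<in> children N F ((v # p) ! (i + 1))) \<and>
      (v # p) ! Suc k \<in> children N F ((v # p) ! (Suc k - 1)) \<and> (v # p) ! (Suc k - 2) < (v # p) ! Suc k"
    using k unfolding cane_path_def by auto
  moreover have "cane_path N F p \<longleftrightarrow> (\<forall>i<k - 1. p ! i \<in> children N F (p ! (i + 1))) \<and>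
      p ! k \<in> children N F (p ! (k - 1)) \<and> p ! (k - 2) < p ! k"
    using k unfolding cane_path_def by auto
  moreover have "(v # p) ! Suc k = p ! k" "(v # p) ! (Suc k - 1) = p ! (k - 1)"
      "(v # p) ! (Suc k - 2) = p ! (k - 2)"
    using k by (auto simp: nth_Cons split: nat.splits) (metis Suc_diff_le diff_Suc_Suc diff_Suc_1 numeral_2_eq_2 old.nat.inject)
  moreover have "\<nexists>a w. p = [a, w]" using False by auto
  ultimately show ?thesis by simp
qed

lemma finite_labeled_graph: "labeled_graph M G \<Longrightarrow> finite G"
  by (rule finite_subset[of _ "Pow {1..M}"]) (auto simp: labeled_graph_def)

context
  fixes N t assumes full: "full_trace N t"
begin

lemma activation_split:
  assumes "t = t1 @ (a, U) # t2"
  shows "activation t a = length t1"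
    and "activation t w < length t1 \<Longrightarrow> w \<in> insert N (found t1)"
    and "w \<in> {1..N} \<Longrightarrow> length t1 < activation t w \<longleftrightarrow> w \<notin> insert a (fst ` set t1)"
proof -
  note s = full_trace_split[OF full assms]
  show a: "activation t a = length t1"
    using activation_append(1)[of a t1 U t2] s assms by simp
  show "length t1 < activation t w \<longleftrightarrow> w \<notin> insert a (fst ` set t1)" 
    using activation_append(2)[of a t1 w U t2] activation_mem[of w t1 "(a, U) # t2"] a s assms
    by (metis insertE less_asym less_irrefl)
  show "w \<in> insert N (found t1)" if "activation t w < length t1"
    using activation_append(2)[of a t1 w U t2] that a s assms by (metis insert_iff less_asym less_irrefl subsetD)
qed

lemma activation_inj: "u \<in> {1..N} \<Longrightarrow> v \<in> {1..N} \<Longrightarrow> activation t u = activation t v \<Longrightarrow> u = v"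
proof -
  assume uv: "u \<in> {1..N}" "v \<in> {1..N}" "activation t u = activation t v"
  have "fst (t ! activation t x) = x" if x: "x \<in> {1..N}" for x
  proof -
    obtain U where "(x, U) \<in> set t" using full_trace_activated(2)[OF full] x by (metis imageE prod.collapse)
    then obtain t1 t2 where t: "t = t1 @ (x, U) # t2" by (metis split_list)
    then show ?thesis using activation_split(1)[OF t] by simp
  qed
  then show ?thesis using uv by metis
qed

lemma snapshot_exists: "(a, U) \<in> set t \<Longrightarrow> \<exists>Y. (a, U, Y) \<in> set (snapshots [N] t)"
proof -
  assume "(a, U) \<in> set t"
  then have "(a, U) \<in> set (map (\<lambda>(a, U, Y). (a, U)) (snapshots [N] t))"
    using snapshots_trace[OF full_trace_search[OF full]] by simp
  then show ?thesis by auto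
qed

lemma snapshot_split:
  assumes "(a, U, Y) \<in> set (snapshots [N] t)"
  shows "\<exists>t1 t2. t = t1 @ (a, U) # t2 \<and> set Y = insert N (found t1) - insert a (fst ` set t1) \<and> distinct Y"
  using snapshots_append[OF full_trace_search[OF full] assms] by auto

lemma snapshot_activation:
  assumes "(a, U, Y) \<in> set (snapshots [N] t)" "w \<in> set Y"
  shows "activation t a < activation t w" "a \<in> {1..N}" "w \<in> {1..N}"
proof -
  obtain t1 t2 where t: "t = t1 @ (a, U) # t2" and Y: "set Y = insert N (found t1) - insert a (fst ` set t1)"
    using snapshot_split[OF assms(1)] by auto
  show w: "w \<in> {1..N}" 
  proof -
    have "w = N \<or> w \<in> found t" using Y assms(2) unfolding t by auto
    moreover have "N \<in> {1..N}" using full by (simp add: full_trace_def)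
    ultimately show ?thesis unfolding found_full_trace[OF full] by auto
  qed
  have "a \<in> fst ` set t" using t by simp
  then show "a \<in> {1..N}" using full_trace_activated(2)[OF full] by blast
  show "activation t a < activation t w"
    using activation_split(1,3)[OF t] w Y assms(2) by auto
qed

lemma snapshot_unique:
  assumes "(a, U, Y) \<in> set (snapshots [N] t)" "(a, W, Z) \<in> set (snapshots [N] t)"
  shows "U = W \<and> Y = Z"
proof -
  have "map fst (snapshots [N] t) = map fst (map (\<lambda>(a, U, Y). (a, U)) (snapshots [N] t))" by auto
  then have "distinct (map fst (snapshots [N] t))"
    unfolding snapshots_trace[OF full_trace_search[OF full]] using full_trace_activated(1)[OF full] by (rule ssubst)
  from eq_key_imp_eq_value[OF this assms] show ?thesis by simp
qed

lemma connected_supergraph: "trace_edges t \<subseteq> G \<Longrightarrow> lg_connected N G"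
proof -
  assume "trace_edges t \<subseteq> G"
  then have "adjacent (trace_edges t) \<le> adjacent G" by blast
  then have "(adjacent (trace_edges t))\<^sup>*\<^sup>* \<le> (adjacent G)\<^sup>*\<^sup>*" by (rule rtranclp_mono)
  then show ?thesis
    using trace_edges_connected[OF full] unfolding lg_connected_def by blast
qed

text \<open>Orient an edge of \<open>G\<close> from the node \<open>u\<close> activated first to
  \<open>v\<close>. When \<open>u\<close> becomes active, \<open>v\<close> is either unvisited and
  becomes a child, or visited and waiting, which makes the edge a cane edge.\<close>

lemma forest_sandwich:
  assumes G: "labeled_graph N G" "lg_connected N G" and eq: "nfs_forest N G = trace_edges t"
  shows "trace_edges t \<subseteq> G" "G \<subseteq> trace_edges t \<union> cane_edges N t"
proof -
  obtain t' where t': "full_trace N t'" "follows (unvisited_nbrs G) {N} t'"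
    using full_trace_exists[OF G] full by (auto simp: full_trace_def)
  then have "t' = t"
    using nfs_forest_trace[OF G(2) t'] eq full_trace_unique[OF t'(1) full] by simp
  with t' have fol: "follows (unvisited_nbrs G) {N} t" by simp
  then show "trace_edges t \<subseteq> G" by (rule follows_nbrs_subset)
  have *: "{u, v} \<in> trace_edges t \<union> cane_edges N t"
    if uv: "adjacent G u v" "activation t u < activation t v" for u v
  proof -
    have nodes: "u \<in> {1..N}" "v \<in> {1..N}" using labeled_graph_adjacent[OF G(1) uv(1)] by auto
    then obtain U where U: "(u, U) \<in> set t" using full_trace_activated(2)[OF full] by (metis imageE prod.collapse)
    then obtain Y where Y: "(u, U, Y) \<in> set (snapshots [N] t)" using snapshot_exists by blast
    obtain t1 t2 where t: "t = t1 @ (u, U) # t2"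
      and sY: "set Y = insert N (found t1) - insert u (fst ` set t1)"
      using snapshot_split[OF Y] by auto
    have "U = unvisited_nbrs G (insert N (found t1)) u"
      using fol unfolding t follows_append by simp
    then consider "v \<in> U" | "v \<in> insert N (found t1)"
      using uv(1) by (auto simp: unvisited_nbrs_def)
    then show ?thesis
    proof cases
      case 1
      then show ?thesis using U by (auto simp: trace_edges_def)
    next
      case 2
      then have "v \<in> set Y"
        using activation_split(1,3)[OF t] uv(2) nodes(2) sY by auto
      then show ?thesis using Y by (auto simp: cane_edges_def)
    qed
  qed
  show "G \<subseteq> trace_edges t \<union> cane_edges N t"
  proof
    fix E assume "E \<in> G"
    then obtain u v where E: "E = {u, v}" "u \<in> {1..N}" "v \<in> {1..N}" "u \<noteq> v"
      using G(1) by (auto simp: labeled_graph_def)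
    then have "activation t u < activation t v \<or> activation t v < activation t u"
      using activation_inj by (meson linorder_neqE_nat)
    then show "E \<in> trace_edges t \<union> cane_edges N t"
      using *[of u v] *[of v u] E \<open>E \<in> G\<close> by (auto simp: insert_commute)
  qed
qed

text \<open>It suffices that \<open>t\<close> obeys the rule of \<open>G\<close> at each activation.
  An unvisited neighbour of \<open>a\<close> is not activated before \<open>a\<close>, so it is not
  the parent and \<open>a\<close> does not wait below it; nor is it waiting itself. Only children
  remain.\<close>

lemma sandwich_forest:
  assumes G: "trace_edges t \<subseteq> G" "G \<subseteq> trace_edges t \<union> cane_edges N t"
  shows "nfs_forest N G = trace_edges t"
proof (rule nfs_forest_trace[OF connected_supergraph[OF G(1)] full], rule follows_splitI)
  fix t1 a U t2 assume t: "t = t1 @ (a, U) # t2"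
  let ?V = "insert N (found t1)"
  note s = full_trace_split[OF full t]
  have U: "(a, U) \<in> set t" using t by simp
  have "u \<in> U" if u: "adjacent G a u" "u \<notin> ?V" for u
  proof -
    have late: "\<not> activation t u < activation t a"
      using activation_split(1,2)[OF t] u(2) by metis
    from u(1) G(2) consider "child_arc t a u" | "child_arc t u a"
      | W Y where "(a, W, Y) \<in> set (snapshots [N] t)" "u \<in> set Y"
      | W Y where "(u, W, Y) \<in> set (snapshots [N] t)" "a \<in> set Y"
      using adjacent_trace_edges[where t = t and x = a and y = u] by (fastforce simp: cane_edges_def doubleton_eq_iff)
    then show ?thesis
    proof cases
      case 1
      then show ?thesis using U full_trace_activated(1)[OF full] by (auto simp: child_arc_def dest: eq_key_imp_eq_value)
    next
      case 2
      then show ?thesis using child_arc_activation[OF full] late by blast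
    next
      case 3
      obtain s1 s2 where s12: "t = s1 @ (a, W) # s2" "set Y = insert N (found s1) - insert a (fst ` set s1)"
        using snapshot_split[OF 3(1)] by auto
      then have "length s1 = length t1"
        using activation_split(1)[OF t] activation_split(1)[OF s12(1)] by simp
      then have "s1 = t1" using t s12(1) by simp
      then show ?thesis using s12(2) 3(2) u(2) by auto
    next
      case 4
      then show ?thesis using snapshot_activation late by blast
    qed
  qed
  moreover have "adjacent G a u \<and> u \<notin> ?V" if "u \<in> U" for u
    using that U s(4) G(1) by (auto simp: trace_edges_def)
  ultimately show "U = unvisited_nbrs G ({N} \<union> found t1) a"
    by (auto simp: unvisited_nbrs_def)
qed

lemma cane_edges_labeled_graph: "labeled_graph N (cane_edges N t)"
  unfolding labeled_graph_def cane_edges_def using snapshot_activation by (fastforce)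

text \<open>A node waiting below \<open>a\<close> was visited before the children of
  \<open>a\<close> and becomes active later than \<open>a\<close>, so it is neither child nor
  parent.\<close>

lemma cane_edges_disjoint: "cane_edges N t \<inter> trace_edges t = {}"
proof -
  have False if Y: "(a, U, Y) \<in> set (snapshots [N] t)" "w \<in> set Y" and e: "{a, w} \<in> trace_edges t" for a U Y w
  proof -
    obtain t1 t2 where t: "t = t1 @ (a, U) # t2" "set Y = insert N (found t1) - insert a (fst ` set t1)"
      using snapshot_split[OF Y(1)] by auto
    have "child_arc t a w \<or> child_arc t w a" using e adjacent_trace_edges by simp
    moreover have "\<not> child_arc t w a"
      using snapshot_activation(1)[OF Y] child_arc_activation[OF full] by (meson less_asym)
    ultimately obtain W where "(a, W) \<in> set t" "w \<in> W" by (auto simp: child_arc_def)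
    then have "w \<in> U" using t full_trace_activated(1)[OF full] by (metis eq_key_imp_eq_value in_set_conv_decomp)
    then show False using full_trace_split(4)[OF full t(1)] t(2) Y(2) by auto
  qed
  then show ?thesis by (auto simp: cane_edges_def)
qed

lemma card_forest_fiber:
  "card {G. labeled_graph N G \<and> lg_connected N G \<and> nfs_forest N G = trace_edges t} =
     2 ^ card (cane_edges N t)"
proof -
  let ?T = "trace_edges t" and ?C = "cane_edges N t"
  \<comment> \<open>The fiber is the interval between the tree and its union with all cane edges:
    each cane edge is chosen or not.\<close>
  have "{G. labeled_graph N G \<and> lg_connected N G \<and> nfs_forest N G = ?T} = (\<union>) ?T ` Pow ?C"
  proof (intro equalityI subsetI)
    fix G assume "G \<in> {G. labeled_graph N G \<and> lg_connected N G \<and> nfs_forest N G = ?T}"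
    then have "?T \<subseteq> G" "G \<subseteq> ?T \<union> ?C" using forest_sandwich by blast+
    then show "G \<in> (\<union>) ?T ` Pow ?C" by (intro image_eqI[of _ _ "G - ?T"]) auto
  next
    fix G assume "G \<in> (\<union>) ?T ` Pow ?C"
    then have G: "?T \<subseteq> G" "G \<subseteq> ?T \<union> ?C" by auto
    moreover have "labeled_graph N G"
      using G(2) cane_edges_labeled_graph trace_edges_labeled_graph[OF full]
      unfolding labeled_graph_def by blast
    ultimately show "G \<in> {G. labeled_graph N G \<and> lg_connected N G \<and> nfs_forest N G = ?T}"
      using sandwich_forest connected_supergraph by blast
  qed
  moreover have "inj_on ((\<union>) ?T) (Pow ?C)"
    using cane_edges_disjoint by (intro inj_onI) blast
  ultimately show ?thesis
    using finite_labeled_graph[OF cane_edges_labeled_graph] by (simp add: card_image card_Pow)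
qed

section \<open>Cane paths and the stack\<close>

lemma root_snapshot: "(N, U, Y) \<in> set (snapshots [N] t) \<Longrightarrow> Y = []"
proof -
  assume Y: "(N, U, Y) \<in> set (snapshots [N] t)"
  have "w \<notin> set Y" for w
  proof
    assume w: "w \<in> set Y"
    obtain t1 t2 where t: "t = t1 @ (N, U) # t2" using snapshot_split[OF Y] by auto
    obtain W r where r: "t = (N, W) # r" using full_trace_search[OF full] by (cases t) auto
    have "t1 = []" using full_trace_activated(1)[OF full] t r by (cases t1) auto
    then show False using snapshot_split[OF Y] w full_trace_activated(1)[OF full] t by (cases rule: exE) (auto simp: Cons_eq_append_conv)
  qed
  then show ?thesis by (cases Y) auto
qed

text \<open>Induction from parent to child: a cane path from \<open>v\<close> ends at a right
  sibling or is \<open>v\<close> followed by a cane path from the parent, and the stack below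
  \<open>v\<close> splits in the same way. With \<open>last\<close> as the bijection, the end point
  is seen to determine the path, which goes beyond the count.\<close>

lemma cane_paths_below:
  "(v, U, Y) \<in> set (snapshots [N] t) \<Longrightarrow>
     bij_betw last {p. cane_path N (trace_edges t) p \<and> hd p = v} (set Y)"
proof (induction "activation t v" arbitrary: v U Y rule: less_induct)
  case less
  let ?T = "trace_edges t"
  let ?P = "\<lambda>v. {p. cane_path N ?T p \<and> hd p = v}"
  have v: "v \<in> {1..N}"
    using snapshot_split[OF less.prems] full_trace_activated(2)[OF full] by force
  note ch = children_child_arc[OF full]
  have ne: "p \<noteq> []" if "cane_path N ?T p" for p using that by (auto simp: cane_path_def)
  show ?case
  proof (cases "v = N")
    case True
    have "\<not> child_arc t a N" for a using child_arc_nodes[OF full] by blast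
    moreover have "\<exists>a. child_arc t a v" if p: "p \<in> ?P v" for p
    proof -
      obtain q where "p = v # q" using p ne by (cases p) auto
      then show ?thesis using p by (auto simp: cane_path_Cons ch)
    qed
    ultimately have "?P v = {}" using True by blast
    moreover have "Y = []" using root_snapshot less.prems True by blast
    ultimately show ?thesis by (simp only: bij_betw_def) simp
  next
    case False
    then obtain a where a: "child_arc t a v" using parent_exists[OF full v] by blast
    then obtain A where A: "(a, A) \<in> set t" "v \<in> A" by (auto simp: child_arc_def)
    then obtain Ya where Ya: "(a, A, Ya) \<in> set (snapshots [N] t)" using snapshot_exists by blast
    have fA: "finite A" using search_trace_fresh[OF full_trace_search[OF full] A(1)] by blast
    then obtain X Z where XZ: "sorted_list_of_set A = X @ v # Z"
      using A(2) by (metis set_sorted_list_of_set split_list)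
    obtain W where "(v, W, Z @ Ya) \<in> set (snapshots [N] t)"
      using snapshots_child[OF full_trace_search[OF full] Ya XZ] by blast
    then have Y: "Y = Z @ Ya" using snapshot_unique less.prems by blast
    have "distinct Y" using snapshot_split[OF less.prems] by blast
    \<comment> \<open>A node occurs only once in the stack, so the two parts are disjoint and their
      bijections can be glued.\<close>
    then have disj: "{w \<in> A. v < w} \<inter> set Ya = {}" and sY: "set Y = {w \<in> A. v < w} \<union> set Ya"
      using sorted_list_of_set_split[OF XZ fA] Y by auto
    have chA: "child_arc t a w \<longleftrightarrow> w \<in> A" for w
      using A(1) full_trace_activated(1)[OF full] by (auto simp: child_arc_def dest: eq_key_imp_eq_value)
    have par: "child_arc t b v \<longleftrightarrow> b = a" for b using child_arc_parent[OF full] a by blast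
    have "?P v = (\<lambda>w. [v, a, w]) ` {w \<in> A. v < w} \<union> (#) v ` ?P a"
    proof (intro equalityI subsetI)
      fix p assume p: "p \<in> ?P v"
      then obtain q where "p = v # q" using ne by (cases p) auto
      with p show "p \<in> (\<lambda>w. [v, a, w]) ` {w \<in> A. v < w} \<union> (#) v ` ?P a"
        by (auto simp: cane_path_Cons[of N ?T v] ch par chA)
    qed (auto simp: cane_path_Cons[of N ?T v] ch par chA A(2))
    moreover have "bij_betw last ((\<lambda>w. [v, a, w]) ` {w \<in> A. v < w}) {w \<in> A. v < w}"
      by (auto simp: bij_betw_def inj_on_def image_image)
    moreover have "bij_betw last ((#) v ` ?P a) (set Ya)"
    proof -
      have IH: "bij_betw last (?P a) (set Ya)"
        using less.hyps[OF child_arc_activation[OF full a] Ya] .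
      have "last (v # p) = last p" if "p \<in> ?P a" for p using that ne by auto
      then have "bij_betw (last \<circ> (#) v) (?P a) (set Ya)"
        using IH by (subst bij_betw_cong[of _ _ last]) auto
      moreover have "bij_betw ((#) v) (?P a) ((#) v ` ?P a)"
        by (auto simp: bij_betw_def inj_on_def)
      ultimately show ?thesis by (simp add: bij_betw_comp_iff)
    qed
    ultimately show ?thesis
      unfolding sY using disj by (simp only:) (rule bij_betw_combine)
  qed
qed

lemma cane_paths_from_snapshot:
  assumes "(v, U, Y) \<in> set (snapshots [N] t)"
  shows "cane_paths_from N (trace_edges t) v = length Y"
  using bij_betw_same_card[OF cane_paths_below[OF assms]] snapshot_split[OF assms]
  by (auto simp: cane_paths_from_def distinct_card)

lemma cane_path_hd: "cane_path N (trace_edges t) p \<Longrightarrow> hd p \<in> {1..N}"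
  by (cases p) (force simp: cane_path_def, force simp: cane_path_Cons children_def)

lemma cane_snapshot: "v \<in> {1..N} \<Longrightarrow> \<exists>U Y. (v, U, Y) \<in> set (snapshots [N] t)"
  using snapshot_exists full_trace_activated(2)[OF full] by (metis (no_types, opaque_lifting) imageE prod.collapse)

text \<open>The edge is unordered, but its end activated first is the start of the path. So the edge
  gives back start and end, and these determine the path.\<close>

lemma cane_paths_edges:
  "bij_betw (\<lambda>p. {hd p, last p}) {p. cane_path N (trace_edges t) p} (cane_edges N t)"
proof (rule bij_betwI')
  let ?P = "{p. cane_path N (trace_edges t) p}"
  have hd_last: "\<exists>U Y. (hd p, U, Y) \<in> set (snapshots [N] t) \<and> last p \<in> set Y" if p: "p \<in> ?P" for p
  proof -
    obtain U Y where Y: "(hd p, U, Y) \<in> set (snapshots [N] t)"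
      using p cane_snapshot[OF cane_path_hd, of p] by blast
    then have "last p \<in> set Y" using bij_betwE[OF cane_paths_below[OF Y]] p by blast
    then show ?thesis using Y by blast
  qed
  show "{hd p, last p} = {hd q, last q} \<longleftrightarrow> p = q" if p: "p \<in> ?P" and q: "q \<in> ?P" for p q
  proof
    assume eq: "{hd p, last p} = {hd q, last q}"
    have "activation t (hd p) < activation t (last p)" "activation t (hd q) < activation t (last q)"
      using hd_last[OF p] hd_last[OF q] snapshot_activation by blast+
    then have "hd p = hd q" "last p = last q" using eq by (auto simp: doubleton_eq_iff)
    moreover obtain U Y where "(hd p, U, Y) \<in> set (snapshots [N] t)" using hd_last[OF p] by blast
    ultimately show "p = q"
      using cane_paths_below[of "hd p" U Y] p q by (auto simp: bij_betw_def inj_on_def)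
  qed auto
  show "{hd p, last p} \<in> cane_edges N t" if "p \<in> ?P" for p
    using hd_last[OF that] by (auto simp: cane_edges_def)
  show "\<exists>p\<in>?P. E = {hd p, last p}" if E: "E \<in> cane_edges N t" for E
  proof -
    obtain a U Y w where a: "E = {a, w}" "(a, U, Y) \<in> set (snapshots [N] t)" "w \<in> set Y"
      using E by (auto simp: cane_edges_def)
    then have "w \<in> last ` {p. cane_path N (trace_edges t) p \<and> hd p = a}"
      using cane_paths_below[OF a(2)] by (simp add: bij_betw_def)
    then show ?thesis using a(1) by auto
  qed
qed

lemma card_cane_edges: "card (cane_edges N t) = cane_paths_total N (trace_edges t)"
  unfolding cane_paths_total_def using bij_betw_same_card[OF cane_paths_edges] by simp

lemma cane_paths_total_sum:
  "cane_paths_total N (trace_edges t) = (\<Sum>v\<in>{1..N}. cane_paths_from N (trace_edges t) v)"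
proof -
  let ?P = "\<lambda>v. {p. cane_path N (trace_edges t) p \<and> hd p = v}"
  have "{p. cane_path N (trace_edges t) p} = (\<Union>v\<in>{1..N}. ?P v)"
    using cane_path_hd by blast
  moreover have "finite (?P v)" if v: "v \<in> {1..N}" for v
  proof -
    obtain U Y where "(v, U, Y) \<in> set (snapshots [N] t)" using cane_snapshot[OF v] by blast
    from bij_betw_finite[OF cane_paths_below[OF this]] show ?thesis by simp
  qed
  ultimately show ?thesis
    unfolding cane_paths_total_def cane_paths_from_def by (simp add: card_UN_disjoint disjoint_iff)
qed

lemma visit_code_cane_paths: "(v, j) \<in> set (visit_code [N] t) \<Longrightarrow> cane_paths_from N (trace_edges t) v = j"
  using visit_code_snapshots[OF full_trace_search[OF full]] cane_paths_from_snapshot by blast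

end


section \<open>Codes of trees\<close>

text \<open>The root \<open>n + 1\<close> has position 0 and is left out. It is the initial stack,
  of length 1, so the first depth must be 0.\<close>

definition tree_codes :: "nat \<Rightarrow> (nat \<times> nat) list set" where
  "tree_codes n = {q. length q = n \<and> distinct (map fst q) \<and> fst ` set q = {1..n} \<and>
     successively admissible q \<and> starts_below 1 q}"

definition tree_trace :: "nat \<Rightarrow> lgraph \<Rightarrow> trace" where
  "tree_trace N T = (THE t. full_trace N t \<and> trace_edges t = T)"

definition tree_code :: "nat \<Rightarrow> lgraph \<Rightarrow> (nat \<times> nat) list" where
  "tree_code n T = visit_code [n + 1] (tree_trace (n + 1) T)"

lemma tree_trace:
  assumes "labeled_tree N T" "1 \<le> N"
  shows "full_trace N (tree_trace N T)" "trace_edges (tree_trace N T) = T"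
proof -
  have "\<exists>!t. full_trace N t \<and> trace_edges t = T"
    using tree_trace_exists[OF assms] full_trace_unique by blast
  from theI'[OF this] show "full_trace N (tree_trace N T)" "trace_edges (tree_trace N T) = T"
    by (simp_all add: tree_trace_def)
qed

lemma visit_code_in_tree_codes:
  assumes "full_trace (n + 1) t"
  shows "visit_code [n + 1] t \<in> tree_codes n"
proof -
  note s = full_trace_search[OF assms]
  have "fst ` set (visit_code [n + 1] t) = set (map fst (visit_code [n + 1] t))" by simp
  also have "\<dots> = {1..n}"
    unfolding map_fst_visit_code[OF s] set_visit_list[OF s] found_full_trace[OF assms] by auto
  finally have f: "fst ` set (visit_code [n + 1] t) = {1..n}" .
  have d: "distinct (map fst (visit_code [n + 1] t))"
    unfolding map_fst_visit_code[OF s] by (rule distinct_visit_list[OF s])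
  have "length (visit_code [n + 1] t) = n"
    using distinct_card[OF d] f by simp
  then show ?thesis
    using f d visit_code_admissible[OF s] visit_code_starts_below[OF s] by (simp add: tree_codes_def)
qed

lemma tree_code_bij: "bij_betw (tree_code n) {T. labeled_tree (n + 1) T} (tree_codes n)"
proof (rule bij_betwI')
  fix T T' assume "T \<in> {T. labeled_tree (n + 1) T}" "T' \<in> {T. labeled_tree (n + 1) T}"
  then show "tree_code n T = tree_code n T' \<longleftrightarrow> T = T'"
    using tree_trace[of "n + 1" T] tree_trace[of "n + 1" T'] visit_code_inj full_trace_search
    by (metis le_add2 mem_Collect_eq tree_code_def)
next
  fix T assume "T \<in> {T. labeled_tree (n + 1) T}"
  then show "tree_code n T \<in> tree_codes n"
    using tree_trace[of "n + 1" T] visit_code_in_tree_codes by (simp add: tree_code_def)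
next
  fix q assume q: "q \<in> tree_codes n"
  then obtain t where t: "search_trace {n + 1} [n + 1] t" "visit_code [n + 1] t = q"
    using visit_code_surj[of q "[n + 1]" "{n + 1}"] by (auto simp: tree_codes_def)
  have "found t = set (map fst q)"
    using map_fst_visit_code[OF t(1)] set_visit_list[OF t(1)] t(2) by simp
  then have full: "full_trace (n + 1) t"
    using t q by (auto simp: full_trace_def tree_codes_def)
  then have "labeled_tree (n + 1) (trace_edges t)" by (rule trace_edges_tree)
  moreover from this have "tree_trace (n + 1) (trace_edges t) = t"
    using full_trace_unique full tree_trace by (metis le_add2)
  ultimately show "\<exists>T\<in>{T. labeled_tree (n + 1) T}. q = tree_code n T"
    using t(2) by (auto simp: tree_code_def)
qed

text \<open>The root occupies position 0, which shifts the entry with index \<open>i\<close> to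
  position \<open>Suc i\<close>.\<close>

lemma nfs_position_tree_code:
  assumes T: "labeled_tree (n + 1) T" and i: "i < n"
  shows "nfs_position (n + 1) T (fst (tree_code n T ! i)) = Suc i"
    and "cane_paths_from (n + 1) T (fst (tree_code n T ! i)) = snd (tree_code n T ! i)"
proof -
  define t where "t = tree_trace (n + 1) T"
  have t: "full_trace (n + 1) t" "trace_edges t = T"
    using tree_trace[OF T] by (simp_all add: t_def)
  define q where "q = tree_code n T"
  have q: "q = visit_code [n + 1] t" by (simp add: q_def t_def tree_code_def)
  have qc: "q \<in> tree_codes n" unfolding q by (rule visit_code_in_tree_codes[OF t(1)])
  have ord: "nfs_order (n + 1) T = (n + 1) # map fst q"
    using nfs_order_trace[OF t(1)] map_fst_visit_code[OF full_trace_search[OF t(1)]] t(2) q by simp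
  have d: "distinct ((n + 1) # map fst q)" using qc by (auto simp: tree_codes_def)
  have len: "length q = n" using qc by (simp add: tree_codes_def)
  have "nfs_position (n + 1) T (fst (q ! i)) = Suc i"
    unfolding nfs_position_def ord
  proof (rule the_equality)
    show "Suc i < length ((n + 1) # map fst q) \<and> ((n + 1) # map fst q) ! Suc i = fst (q ! i)"
      using i len by simp
    fix k assume "k < length ((n + 1) # map fst q) \<and> ((n + 1) # map fst q) ! k = fst (q ! i)"
    then show "k = Suc i"
      using nth_eq_iff_index_eq[OF d, of k "Suc i"] i len by simp
  qed
  then show "nfs_position (n + 1) T (fst (tree_code n T ! i)) = Suc i" by (simp add: q_def)
  have "(fst (q ! i), snd (q ! i)) \<in> set (visit_code [n + 1] t)"
    using i len nth_mem[of i q] unfolding q by simp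
  from visit_code_cane_paths[OF t(1) this]
  show "cane_paths_from (n + 1) T (fst (tree_code n T ! i)) = snd (tree_code n T ! i)"
    by (simp add: q_def t(2))
qed

lemma tree_codes_bij_labels:
  assumes "q \<in> tree_codes n"
  shows "bij_betw (\<lambda>i. fst (q ! i)) {..<n} {1..n}"
proof -
  have "bij_betw (\<lambda>i. map fst q ! i) {..<n} {1..n}"
    using assms bij_betw_nth[of "map fst q" "{..<n}" "{1..n}"] by (simp add: tree_codes_def)
  then show ?thesis
    using assms by (subst bij_betw_cong[of _ _ "\<lambda>i. map fst q ! i"]) (auto simp: tree_codes_def)
qed

lemma cane_paths_total_tree_code:
  assumes T: "labeled_tree (n + 1) T"
  shows "cane_paths_total (n + 1) T = (\<Sum>i<n. snd (tree_code n T ! i))"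
proof -
  define t where "t = tree_trace (n + 1) T"
  have t: "full_trace (n + 1) t" "trace_edges t = T"
    using tree_trace[OF T] by (simp_all add: t_def)
  have q: "tree_code n T \<in> tree_codes n"
    using bij_betwE[OF tree_code_bij] T by blast
  \<comment> \<open>Nothing lies below the root in the stack, so the sum over the code misses no
    cane path.\<close>
  have root: "cane_paths_from (n + 1) T (n + 1) = 0"
  proof -
    obtain U Y where Y: "(n + 1, U, Y) \<in> set (snapshots [n + 1] t)"
      using cane_snapshot[OF t(1), of "n + 1"] by auto
    then show ?thesis
      using cane_paths_from_snapshot[OF t(1) Y] root_snapshot[OF t(1) Y] t(2) by simp
  qed
  have "cane_paths_total (n + 1) T = (\<Sum>v\<in>{1..n + 1}. cane_paths_from (n + 1) T v)"
    using cane_paths_total_sum[OF t(1)] t(2) by simp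
  also have "\<dots> = (\<Sum>v\<in>{1..n}. cane_paths_from (n + 1) T v)"
    using root by simp
  also have "\<dots> = (\<Sum>i<n. cane_paths_from (n + 1) T (fst (tree_code n T ! i)))"
    by (rule sum.reindex_bij_betw[OF tree_codes_bij_labels[OF q], symmetric])
  also have "\<dots> = (\<Sum>i<n. snd (tree_code n T ! i))"
    using nfs_position_tree_code(2)[OF T] by simp
  finally show ?thesis .
qed

lemma card_nfs_forest_fiber:
  assumes "labeled_tree (n + 1) T"
  shows "card {G. labeled_graph (n + 1) G \<and> lg_connected (n + 1) G \<and> nfs_forest (n + 1) G = T} =
    2 ^ cane_paths_total (n + 1) T"
proof -
  define t where "t = tree_trace (n + 1) T"
  have t: "full_trace (n + 1) t" "trace_edges t = T"
    using tree_trace[OF assms] by (simp_all add: t_def)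
  show ?thesis
    using card_forest_fiber[OF t(1)] card_cane_edges[OF t(1)] unfolding t(2) by simp
qed

lemma nfs_forest_tree:
  assumes "labeled_graph N G" "lg_connected N G" "1 \<le> N"
  shows "labeled_tree N (nfs_forest N G)"
proof -
  obtain t where "full_trace N t" "follows (unvisited_nbrs G) {N} t"
    using full_trace_exists[OF assms] by blast
  then show ?thesis
    using nfs_forest_trace[OF assms(2)] trace_edges_tree by simp
qed

lemma finite_labeled_graphs: "finite {G. labeled_graph N G}"
  by (rule finite_subset[of _ "Pow (Pow {1..N})"]) (auto simp: labeled_graph_def)

lemma finite_labeled_trees: "finite {T. labeled_tree N T}"
  by (rule finite_subset[OF _ finite_labeled_graphs[of N]]) (auto simp: labeled_tree_def)

lemma card_connected_graphs:
  assumes "1 \<le> N"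
  shows "card {G. labeled_graph N G \<and> lg_connected N G} =
    (\<Sum>T | labeled_tree N T. card {G. labeled_graph N G \<and> lg_connected N G \<and> nfs_forest N G = T})"
proof -
  have "{G. labeled_graph N G \<and> lg_connected N G} =
    (\<Union>T\<in>{T. labeled_tree N T}. {G. labeled_graph N G \<and> lg_connected N G \<and> nfs_forest N G = T})"
    using nfs_forest_tree[OF _ _ assms] by auto
  moreover have "finite {G. labeled_graph N G \<and> lg_connected N G \<and> nfs_forest N G = T}" for T
    by (rule finite_subset[OF _ finite_labeled_graphs[of N]]) auto
  ultimately show ?thesis
    using finite_labeled_trees by (subst card_UN_disjoint[symmetric]) auto
qed


section \<open>Ordered simplices\<close>

text \<open>The index \<open>f k\<close> names the coordinate whose scaled value comes k-th in the
  chain. With powers of 2 as weights these are the tree simplices, with weights 1 the pieces of the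
  cube.\<close>

definition chain_simplex :: "(nat \<Rightarrow> 'n::finite) \<Rightarrow> (nat \<Rightarrow> real) \<Rightarrow> nat \<Rightarrow> (real ^ 'n) set" where
  "chain_simplex f w n = {x. 1 \<le> x $ f 1 / w 1 \<and>
     (\<forall>k\<in>{1..<n}. x $ f k / w k \<le> x $ f (k + 1) / w (k + 1)) \<and> x $ f n / w n \<le> 2}"

lemma prod_Basis_vec: "(\<Prod>b\<in>Basis. (x :: real ^ 'n::finite) \<bullet> b) = (\<Prod>i\<in>UNIV. x $ i)"
proof -
  have B: "(Basis :: (real ^ 'n) set) = (\<lambda>i. axis i 1) ` UNIV"
    by (auto simp: Basis_vec_def)
  have "inj (\<lambda>i::'n. axis i (1::real))"
    by (auto simp: inj_on_def axis_eq_axis)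
  then show ?thesis
    by (simp add: B prod.reindex inner_axis)
qed

text \<open>Lebesgue measure is characterized by its values on boxes; the preimage of a box is again
  a box, with permuted sides stretched by the factors \<open>w i\<close>.\<close>

lemma lborel_permute_scale:
  fixes p :: "'n::finite \<Rightarrow> 'n" and w :: "'n \<Rightarrow> real"
  assumes p: "bij p" and w: "\<And>i. 0 < w i"
  shows "lborel = scale_measure (ennreal (1 / (\<Prod>i\<in>UNIV. w i)))
    (distr lborel borel (\<lambda>x :: real ^ 'n. \<chi> i. x $ p i / w i))" (is "_ = ?D")
proof (rule lborel_eqI)
  let ?g = "\<lambda>x :: real ^ 'n. \<chi> i. x $ p i / w i"
  have cont: "continuous_on UNIV ?g"
    by (intro continuous_on_vec_lambda continuous_intros) (use w in \<open>auto simp: less_imp_neq[symmetric]\<close>)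
  then have [measurable]: "?g \<in> borel_measurable borel"
    by (rule borel_measurable_continuous_onI)
  fix l u :: "real ^ 'n" assume "\<And>b. b \<in> Basis \<Longrightarrow> l \<bullet> b \<le> u \<bullet> b"
  then have lu: "l $ i \<le> u $ i" for i
    unfolding cart_eq_inner_axis by (metis axis_in_Basis_iff Basis_real_def insertI1)
  define q where "q = inv p"
  have q: "p (q i) = i" "q (p i) = i" for i
    using p by (simp_all add: q_def bij_inv_eq_iff surj_f_inv_f bij_is_surj bij_is_inj)
  let ?m = "\<lambda>v :: real ^ 'n. (\<chi> i. v $ q i * w (q i)) :: real ^ 'n"
  have "?g x \<in> box l u \<longleftrightarrow> x \<in> box (?m l) (?m u)" for x
  proof -
    have "?g x \<in> box l u \<longleftrightarrow> (\<forall>i. l $ i * w i < x $ p i \<and> x $ p i < u $ i * w i)"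
      using w by (simp add: mem_box_cart pos_less_divide_eq pos_divide_less_eq)
    also have "\<dots> \<longleftrightarrow> (\<forall>i. l $ q i * w (q i) < x $ i \<and> x $ i < u $ q i * w (q i))"
      using q by metis
    finally show ?thesis by (simp add: mem_box_cart)
  qed
  then have vim: "?g -` box l u = box (?m l) (?m u)" by auto
  have le: "?m l \<bullet> b \<le> ?m u \<bullet> b" if "b \<in> Basis" for b
    using that lu w by (auto simp: Basis_vec_def inner_axis mult_right_mono less_imp_le)
  have "emeasure ?D (box l u) = ennreal (1 / (\<Prod>i\<in>UNIV. w i)) * ennreal (\<Prod>i\<in>UNIV. (?m u - ?m l) $ i)"
    using emeasure_lborel_box[OF le] unfolding prod_Basis_vec by (simp add: emeasure_distr vim)
  also have "(\<Prod>i\<in>UNIV. (?m u - ?m l) $ i) = (\<Prod>i\<in>UNIV. (u - l) $ q i * w (q i))"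
    by (simp add: algebra_simps)
  also have "\<dots> = (\<Prod>i\<in>UNIV. (u - l) $ i * w i)"
    by (rule prod.reindex_bij_betw) (simp add: q_def p bij_imp_bij_inv)
  also have "\<dots> = (\<Prod>i\<in>UNIV. (u - l) $ i) * (\<Prod>i\<in>UNIV. w i)"
    by (simp only: prod.distrib)
  also have "ennreal (1 / (\<Prod>i\<in>UNIV. w i)) * ennreal ((\<Prod>i\<in>UNIV. (u - l) $ i) * (\<Prod>i\<in>UNIV. w i))
      = ennreal (\<Prod>i\<in>UNIV. (u - l) $ i)"
    using w lu by (subst ennreal_mult'[symmetric])
      (auto simp: prod_nonneg prod_pos less_imp_le order_less_imp_not_eq2)
  finally show "emeasure ?D (box l u) = ennreal (\<Prod>b\<in>Basis. (u - l) \<bullet> b)"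
    by (simp only: prod_Basis_vec)
qed simp

lemma measure_permute_scale_vimage:
  fixes p :: "'n::finite \<Rightarrow> 'n" and w :: "'n \<Rightarrow> real"
  assumes p: "bij p" and w: "\<And>i. 0 < w i" and A: "A \<in> sets borel"
  shows "measure lebesgue ((\<lambda>x :: real ^ 'n. \<chi> i. x $ p i / w i) -` A) =
    (\<Prod>i\<in>UNIV. w i) * measure lebesgue A"
proof -
  let ?g = "\<lambda>x :: real ^ 'n. \<chi> i. x $ p i / w i"
  have cont: "continuous_on UNIV ?g"
    by (intro continuous_on_vec_lambda continuous_intros) (use w in \<open>auto simp: less_imp_neq[symmetric]\<close>)
  then have g: "?g \<in> borel_measurable borel"
    by (rule borel_measurable_continuous_onI)
  then have vA: "?g -` A \<in> sets borel"
    using measurable_sets[OF g A] by simp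
  have pos: "0 < (\<Prod>i\<in>UNIV. w i)" using w by (simp add: prod_pos)
  have "measure lborel A = (1 / (\<Prod>i\<in>UNIV. w i)) * measure (distr lborel borel ?g) A"
    by (subst lborel_permute_scale[where p = p and w = w, OF p w]) (use pos in \<open>simp add: measure_scale_measure\<close>)
  also have "measure (distr lborel borel ?g) A = measure lborel (?g -` A)"
    using g A by (simp add: measure_distr)
  finally show ?thesis
    using pos A vA less_imp_neq[OF pos] by (simp add: measure_completion nonzero_divide_eq_eq mult.commute)
qed

section \<open>Topology and order in chain simplices\<close>

lemma closed_chain_simplex: "closed (chain_simplex f w n)"
proof -
  have "chain_simplex f w n = {x. 1 \<le> x $ f 1 / w 1} \<inter>
     (\<Inter>k\<in>{1..<n}. {x. x $ f k / w k \<le> x $ f (k + 1) / w (k + 1)}) \<inter> {x. x $ f n / w n \<le> 2}"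
    by (auto simp: chain_simplex_def)
  also have "closed \<dots>"
    unfolding divide_inverse
    by (intro closed_Int closed_INT ballI closed_Collect_le continuous_intros)
  finally show ?thesis .
qed

lemma convex_chain_simplex: "convex (chain_simplex f w n)"
proof (rule convexI)
  fix x y :: "real ^ 'a" and u v :: real
  assume xy: "x \<in> chain_simplex f w n" "y \<in> chain_simplex f w n" and uv: "0 \<le> u" "0 \<le> v" "u + v = 1"
  have eq: "(u *\<^sub>R x + v *\<^sub>R y) $ i / c = u * (x $ i / c) + v * (y $ i / c)" for i c
    by (simp add: add_divide_distrib)
  have mono: "u * a + v * b \<le> u * c + v * d" if "a \<le> c" "b \<le> d" for a b c d
    using that uv by (intro add_mono mult_left_mono)
  have const: "u * c + v * c = c" for c
    using uv by (metis distrib_right mult_1)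
  show "u *\<^sub>R x + v *\<^sub>R y \<in> chain_simplex f w n"
    using xy mono[of 1 _ 1] mono[of _ 2 _ 2] mono const[of 1] const[of 2]
    unfolding chain_simplex_def mem_Collect_eq eq by metis
qed

context
  fixes f :: "nat \<Rightarrow> 'n::finite" and n :: nat
  assumes n: "1 \<le> n" and f: "bij_betw f {1..n} UNIV"
begin

lemma chain_simplex_mono:
  assumes "x \<in> chain_simplex f w n" "1 \<le> j" "j \<le> k" "k \<le> n"
  shows "x $ f j / w j \<le> x $ f k / w k"
  using assms(3,4)
proof (induction k rule: dec_induct)
  case (step k)
  then have "x $ f k / w k \<le> x $ f (k + 1) / w (k + 1)"
    using assms(1,2) by (auto simp: chain_simplex_def)
  then show ?case using step by simp
qed simp

lemma chain_simplex_bounds: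
  assumes "x \<in> chain_simplex f w n" "1 \<le> k" "k \<le> n"
  shows "1 \<le> x $ f k / w k" "x $ f k / w k \<le> 2"
proof -
  have "1 \<le> x $ f 1 / w 1" "x $ f n / w n \<le> 2"
    using assms(1) by (auto simp: chain_simplex_def)
  then show "1 \<le> x $ f k / w k" "x $ f k / w k \<le> 2"
    using chain_simplex_mono[OF assms(1), of 1 k] chain_simplex_mono[OF assms(1), of k n] assms by linarith+
qed

lemma card_enumerated_UNIV: "CARD('n) = n"
  using bij_betw_same_card[OF f] by simp

lemma enumeration_surj: "\<exists>k\<in>{1..n}. i = f k"
  using f by (auto simp: bij_betw_def)

lemma bounded_chain_simplex: 
  assumes w: "\<And>k. 0 < w k"
  shows "bounded (chain_simplex f w n)"
proof -
  let ?c = "\<Sum>k\<in>{1..n}. 2 * w k"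
  have "\<bar>x $ i\<bar> \<le> ?c" if x: "x \<in> chain_simplex f w n" for x i
  proof -
    obtain k where k: "k \<in> {1..n}" "i = f k" using enumeration_surj by blast
    have "1 \<le> x $ f k / w k" "x $ f k / w k \<le> 2"
      using chain_simplex_bounds[OF x] k by auto
    then have "0 \<le> x $ i" "x $ i \<le> 2 * w k"
      using w[of k] k by (auto simp: pos_divide_le_eq pos_le_divide_eq)
    moreover have "2 * w k \<le> ?c"
      using w k by (intro member_le_sum[of k "{1..n}" "\<lambda>k. 2 * w k"]) (auto simp: less_imp_le)
    ultimately show ?thesis by linarith
  qed
  then have "norm x \<le> (\<Sum>i\<in>(UNIV::'n set). ?c)" if "x \<in> chain_simplex f w n" for x
    using that norm_le_l1_cart[of x] sum_mono[of UNIV "\<lambda>i. \<bar>x $ i\<bar>" "\<lambda>_. ?c"] by force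
  then show ?thesis by (auto simp: bounded_iff)
qed

lemma lmeasurable_chain_simplex:
  assumes w: "\<And>k. 0 < w k"
  shows "chain_simplex f w n \<in> lmeasurable"
  using bounded_chain_simplex[OF w] closed_chain_simplex[of f w n]
  by (intro lmeasurable_compact) (simp add: compact_eq_bounded_closed)

text \<open>Along a strict chain the rank of a value among all coordinates is its index, so the
  values alone determine the order \<open>f\<close>.\<close>

lemma chain_rank:
  assumes "\<And>j k. 1 \<le> j \<Longrightarrow> j < k \<Longrightarrow> k \<le> n \<Longrightarrow> (z :: 'n \<Rightarrow> real) (f j) < z (f k)" "k \<in> {1..n}"
  shows "card {i. z i \<le> z (f k)} = k"
proof -
  have "{i. z i \<le> z (f k)} = f ` {1..k}"
  proof (intro equalityI subsetI)
    fix i assume i: "i \<in> {i. z i \<le> z (f k)}"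
    obtain j where j: "j \<in> {1..n}" "i = f j" using enumeration_surj by blast
    then have "j \<le> k" using assms(1)[of k j] assms(2) i by (cases "j \<le> k") auto
    then show "i \<in> f ` {1..k}" using j by auto
  next
    fix i assume "i \<in> f ` {1..k}"
    then obtain j where j: "j \<in> {1..k}" "i = f j" by auto
    then show "i \<in> {i. z i \<le> z (f k)}" using assms(1)[of j k] assms(2) by (cases "j = k") auto
  qed
  moreover have "inj_on f {1..k}" using f assms(2) by (auto simp: bij_betw_def intro: inj_on_subset)
  ultimately show ?thesis by (simp add: card_image)
qed

end

lemma chain_order_unique:
  fixes f g :: "nat \<Rightarrow> 'n::finite"
  assumes "1 \<le> n" "bij_betw f {1..n} UNIV" "bij_betw g {1..n} UNIV"
    and "\<And>j k. 1 \<le> j \<Longrightarrow> j < k \<Longrightarrow> k \<le> n \<Longrightarrow> (z :: 'n \<Rightarrow> real) (f j) < z (f k)"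
    and "\<And>j k. 1 \<le> j \<Longrightarrow> j < k \<Longrightarrow> k \<le> n \<Longrightarrow> z (g j) < z (g k)"
    and "k \<in> {1..n}"
  shows "f k = g k"
proof -
  obtain j where j: "j \<in> {1..n}" "f k = g j" using enumeration_surj[OF assms(1,3)] by blast
  have "k = card {i. z i \<le> z (f k)}" using chain_rank[where z = z, OF assms(1,2,4,6)] by simp
  also have "\<dots> = j" using chain_rank[where z = z, OF assms(1,3,5) j(1)] j(2) by simp
  finally show ?thesis using j by simp
qed

lemma rank_bij:
  fixes R :: "'a \<Rightarrow> 'a \<Rightarrow> bool"
  assumes A: "finite A" "card A = n" and irr: "\<And>a. \<not> R a a"
    and tr: "\<And>a b c. a \<in> A \<Longrightarrow> b \<in> A \<Longrightarrow> c \<in> A \<Longrightarrow> R a b \<Longrightarrow> R b c \<Longrightarrow> R a c"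
    and tot: "\<And>a b. a \<in> A \<Longrightarrow> b \<in> A \<Longrightarrow> a \<noteq> b \<Longrightarrow> R a b \<or> R b a"
  shows "\<exists>l. bij_betw l A {1..n} \<and> (\<forall>a\<in>A. \<forall>b\<in>A. R a b \<longleftrightarrow> l a < (l b :: nat))"
proof -
  define l where "l a = Suc (card {b \<in> A. R b a})" for a
  have less: "l a < l b" if "a \<in> A" "b \<in> A" "R a b" for a b
  proof -
    have "{c \<in> A. R c a} \<subset> {c \<in> A. R c b}"
      using that irr tr by blast
    then show ?thesis using A by (simp add: l_def psubset_card_mono)
  qed
  have iff: "R a b \<longleftrightarrow> l a < l b" if "a \<in> A" "b \<in> A" for a b
    using that less tot irr by (metis less_asym less_irrefl)
  have inj: "inj_on l A"
    using less tot by (intro inj_onI) (metis less_irrefl)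
  have "l a \<in> {1..n}" if "a \<in> A" for a
  proof -
    have "{b \<in> A. R b a} \<subset> A" using that irr by blast
    then have "card {b \<in> A. R b a} < n" using A psubset_card_mono by metis
    then show ?thesis by (simp add: l_def)
  qed
  then have "l ` A = {1..n}"
    using inj A by (intro card_subset_eq) (auto simp: card_image)
  then show ?thesis using inj iff unfolding bij_betw_def by blast
qed

lemma negligible_coordinates_eq:
  assumes "i \<noteq> (j :: 'n::finite)"
  shows "negligible {x :: real ^ 'n. x $ i = x $ j}"
proof -
  have "axis i 1 - axis j 1 \<noteq> (0 :: real ^ 'n)"
    using assms by (auto simp: axis_eq_axis)
  then have "negligible {x :: real ^ 'n. (axis i 1 - axis j 1) \<bullet> x = 0}"
    by (intro negligible_hyperplane) auto
  then show ?thesis by (simp add: inner_diff_left inner_axis' )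
qed

lemma chain_simplex_comp_vimage:
  fixes f g :: "nat \<Rightarrow> 'n::finite" and w :: "nat \<Rightarrow> real"
  assumes n: "1 \<le> n" and e: "bij_betw e {1..n} (UNIV :: 'n set)" and f: "bij_betw f {1..n} (UNIV :: 'n set)"
    and w: "\<And>k. 0 < w k"
  shows "measure lebesgue (chain_simplex f w n) =
    (\<Prod>k\<in>{1..n}. w k) * measure lebesgue (chain_simplex e (\<lambda>_. 1) n)"
proof -
  define r where "r = inv_into {1..n} e"
  have r: "bij_betw r UNIV {1..n}" using e by (simp add: r_def bij_betw_inv_into)
  have re: "r (e k) = k" if "k \<in> {1..n}" for k
    using e that by (simp add: r_def bij_betw_def)
  have "bij (f \<circ> r)" using bij_betw_trans[OF r f] .
  moreover have "chain_simplex f w n =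
      (\<lambda>x. \<chi> i. x $ (f \<circ> r) i / w (r i)) -` chain_simplex e (\<lambda>_. 1) n"
    using n by (auto simp: chain_simplex_def re)
  moreover have "(\<Prod>i\<in>UNIV. w (r i)) = (\<Prod>k\<in>{1..n}. w k)"
    by (rule prod.reindex_bij_betw[OF r])
  moreover have "chain_simplex e (\<lambda>_. 1) n \<in> sets borel"
    by (rule borel_closed[OF closed_chain_simplex])
  ultimately show ?thesis
    using measure_permute_scale_vimage[of "f \<circ> r" "\<lambda>i. w (r i)" "chain_simplex e (\<lambda>_. 1) n"] w by simp
qed

text \<open>The cube from 1 to 2 has volume 1 and is the union of \<open>fact n\<close> permuted
  copies of this simplex, which overlap only where two coordinates agree.\<close>

lemma measure_standard_chain_simplex:
  fixes e :: "nat \<Rightarrow> 'n::finite"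
  assumes n: "1 \<le> n" and e: "bij_betw e {1..n} (UNIV :: 'n set)"
  shows "fact n * measure lebesgue (chain_simplex e (\<lambda>_. 1) n) = 1"
proof -
  let ?P = "{p :: 'n \<Rightarrow> 'n. p permutes UNIV}"
  let ?S = "\<lambda>p. chain_simplex (p \<circ> e) (\<lambda>_. 1) n"
  have pe: "bij_betw (p \<circ> e) {1..n} UNIV" if "p \<in> ?P" for p
    using bij_betw_trans[OF e, of p UNIV] that permutes_bij by blast
  have cube: "\<Union> (?S ` ?P) = cbox 1 (2 :: real ^ 'n)"
  proof (intro equalityI subsetI)
    fix x assume "x \<in> \<Union> (?S ` ?P)"
    then obtain p where p: "p \<in> ?P" "x \<in> ?S p" by auto
    have "1 \<le> x $ i \<and> x $ i \<le> 2" for i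
    proof -
      obtain k where "k \<in> {1..n}" "i = (p \<circ> e) k" using enumeration_surj[OF n pe[OF p(1)]] by blast
      then show ?thesis using chain_simplex_bounds[OF n pe[OF p(1)] p(2), of k] by auto
    qed
    then show "x \<in> cbox 1 2" by (simp add: mem_box_cart)
  next
    fix x :: "real ^ 'n" assume x: "x \<in> cbox 1 2"
    define r where "r = inv_into {1..n} e"
    have r: "bij_betw r UNIV {1..n}" using e by (simp add: r_def bij_betw_inv_into)
    \<comment> \<open>Equal coordinates are ordered by their index in \<open>e\<close>, which makes
      \<open>R\<close> a strict total order.\<close>
    define R where "R i j \<longleftrightarrow> x $ i < x $ j \<or> (x $ i = x $ j \<and> r i < r j)" for i j
    have "\<exists>l. bij_betw l UNIV {1..n} \<and> (\<forall>a\<in>UNIV. \<forall>b\<in>UNIV. R a b \<longleftrightarrow> l a < (l b :: nat))"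
    proof (rule rank_bij)
      show "card (UNIV :: 'n set) = n" by (rule card_enumerated_UNIV[OF n e])
      show "R a b \<or> R b a" if "a \<noteq> b" for a b
        using that r by (auto simp: R_def bij_betw_def inj_on_def) (metis linorder_neqE)
    qed (auto simp: R_def)
    then obtain l where l: "bij_betw l UNIV {1..n}" "\<And>a b. R a b \<longleftrightarrow> l a < l b" by blast
    define g where "g = inv_into UNIV l"
    have g: "bij_betw g {1..n} UNIV" using l by (simp add: g_def bij_betw_inv_into)
    have lg: "l (g k) = k" if "k \<in> {1..n}" for k
      using l that by (simp add: g_def bij_betw_def f_inv_into_f)
    have "x $ g k \<le> x $ g (k + 1)" if "k \<in> {1..<n}" for k
      using l(2)[of "g k" "g (k + 1)"] lg[of k] lg[of "k + 1"] that by (auto simp: R_def)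
    then have "x \<in> chain_simplex g (\<lambda>_. 1) n"
      using x by (auto simp: chain_simplex_def mem_box_cart)
    moreover have "g \<circ> r \<in> ?P"
      using bij_betw_trans[OF r g] by (auto intro: bij_imp_permutes)
    moreover have "x \<in> ?S (g \<circ> r) \<longleftrightarrow> x \<in> chain_simplex g (\<lambda>_. 1) n"
      using e n by (auto simp: chain_simplex_def r_def bij_betw_def)
    ultimately show "x \<in> \<Union> (?S ` ?P)" by blast
  qed
  let ?N = "\<Union>(i, j)\<in>{(i, j). i \<noteq> (j :: 'n)}. {x :: real ^ 'n. x $ i = x $ j}"
  have N: "negligible ?N"
    by (rule negligible_Union) (auto intro!: finite_imageI negligible_coordinates_eq)
  \<comment> \<open>Away from \<open>?N\<close> the inequalities are strict, so the point determines
    the permutation.\<close>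
  have sub: "?S p \<inter> ?S q \<subseteq> ?N" if pq: "p \<in> ?P" "q \<in> ?P" "p \<noteq> q" for p q
  proof (rule ccontr)
    assume "\<not> ?S p \<inter> ?S q \<subseteq> ?N"
    then obtain x where x: "x \<in> ?S p" "x \<in> ?S q" "\<And>i j. i \<noteq> j \<Longrightarrow> x $ i \<noteq> x $ j" by auto
    have strict: "x $ (s \<circ> e) j < x $ (s \<circ> e) k"
      if "s \<in> ?P" "x \<in> ?S s" "1 \<le> j" "j < k" "k \<le> n" for s j k
    proof -
      have "(s \<circ> e) j \<noteq> (s \<circ> e) k"
        using inj_on_eq_iff[OF bij_betw_imp_inj_on[OF pe[OF that(1)]], of j k] that(3-5) by simp
      then show ?thesis
        using chain_simplex_mono[OF n pe[OF that(1)] that(2), of j k] that x(3) by fastforce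
    qed
    have "(p \<circ> e) k = (q \<circ> e) k" if "k \<in> {1..n}" for k
      using chain_order_unique[OF n pe[OF pq(1)] pe[OF pq(2)], of "\<lambda>i. x $ i" k]
        strict[OF pq(1) x(1)] strict[OF pq(2) x(2)] that by blast
    then have "p i = q i" for i using enumeration_surj[OF n e, of i] by auto
    then show False using pq(3) by auto
  qed
  have "measure lebesgue (\<Union> (?S ` ?P)) = (\<Sum>p\<in>?P. measure lebesgue (?S p))"
  proof (rule measure_negligible_finite_Union_image)
    show "finite ?P" by (simp add: finite_permutations)
    show "?S p \<in> lmeasurable" if "p \<in> ?P" for p
      using lmeasurable_chain_simplex[OF n pe[OF that]] by simp
    show "pairwise (\<lambda>p q. negligible (?S p \<inter> ?S q)) ?P"
      by (intro pairwiseI negligible_subset[OF N] sub)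
  qed
  also have "\<dots> = (\<Sum>p\<in>?P. measure lebesgue (chain_simplex e (\<lambda>_. 1) n))"
    using chain_simplex_comp_vimage[OF n e pe, of _ "\<lambda>_. 1"] by (intro sum.cong) auto
  also have "\<dots> = fact n * measure lebesgue (chain_simplex e (\<lambda>_. 1) n)"
    using card_permutations[of "UNIV :: 'n set" n] card_enumerated_UNIV[OF n e] by simp
  finally show ?thesis
    by (simp add: cube content_cbox_cart interval_eq_empty_cart)
qed


section \<open>The triangulation of the Cayley polytope\<close>

text \<open>Each defining inequality is a half-space containing the simplex. Its functional is
  nonzero, so the interior of the simplex lies in the open half-space.\<close>

lemma interior_chain_simplex_strict:
  fixes f :: "nat \<Rightarrow> 'n::finite"
  assumes n: "1 \<le> n" and f: "bij_betw f {1..n} UNIV" and w: "\<And>k. 0 < w k"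
    and x: "x \<in> interior (chain_simplex f w n)"
  shows "1 < x $ f 1 / w 1" "k \<in> {1..<n} \<Longrightarrow> x $ f k / w k < x $ f (k + 1) / w (k + 1)" "x $ f n / w n < 2"
proof -
  have half: "a \<bullet> x < b" if "a \<noteq> 0" "\<And>y. y \<in> chain_simplex f w n \<Longrightarrow> a \<bullet> y \<le> b" for a b
  proof -
    have "interior (chain_simplex f w n) \<subseteq> interior {y. a \<bullet> y \<le> b}"
      using that(2) by (intro interior_mono) blast
    then show ?thesis using x that(1) by auto
  qed
  have ax: "axis i (1 / c) \<bullet> y = y $ i / c" for i c and y :: "real ^ 'n"
    by (simp add: inner_axis')
  have mem: "1 \<le> y $ f 1 / w 1" "y $ f n / w n \<le> 2"
    "k \<in> {1..<n} \<Longrightarrow> y $ f k / w k \<le> y $ f (k + 1) / w (k + 1)"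
    if "y \<in> chain_simplex f w n" for y k
    using that unfolding chain_simplex_def by blast+
  have ne: "1 / w k \<noteq> 0" for k using w[of k] by simp
  have "(- axis (f 1) (1 / w 1)) \<bullet> x < - 1"
  proof (rule half)
    show "- axis (f 1) (1 / w 1) \<noteq> 0" using ne[of 1] by simp
  qed (use mem(1) in \<open>simp only: ax inner_minus_left neg_le_iff_le\<close>)
  then show "1 < x $ f 1 / w 1" by (simp only: ax inner_minus_left neg_less_iff_less)
  have "axis (f n) (1 / w n) \<bullet> x < 2"
  proof (rule half)
    show "axis (f n) (1 / w n) \<noteq> 0" using ne[of n] by simp
  qed (use mem(2) in \<open>simp only: ax\<close>)
  then show "x $ f n / w n < 2" by (simp only: ax)
  assume k: "k \<in> {1..<n}"
  then have fk: "f k \<noteq> f (k + 1)" using inj_on_eq_iff[OF bij_betw_imp_inj_on[OF f], of k "k + 1"] by simp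
  have "(axis (f k) (1 / w k) - axis (f (k + 1)) (1 / w (k + 1))) \<bullet> x < 0"
  proof (rule half)
    have "(axis (f k) (1 / w k) - axis (f (k + 1)) (1 / w (k + 1))) $ f k = 1 / w k"
      using fk by (simp add: axis_def)
    then show "axis (f k) (1 / w k) - axis (f (k + 1)) (1 / w (k + 1)) \<noteq> 0"
      using ne[of k] by (metis zero_index)
  qed (use mem(3)[OF _ k] in \<open>simp only: ax inner_diff_left diff_le_0_iff_le\<close>)
  then show "x $ f k / w k < x $ f (k + 1) / w (k + 1)"
    by (simp only: ax inner_diff_left diff_less_0_iff_less)
qed

lemma measure_chain_simplex:
  fixes f :: "nat \<Rightarrow> 'n::finite"
  assumes "1 \<le> n" "bij_betw f {1..n} (UNIV :: 'n set)" "\<And>k. 0 < w k"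
  shows "fact n * measure lebesgue (chain_simplex f w n) = (\<Prod>k\<in>{1..n}. w k)"
  using chain_simplex_comp_vimage[where w = w, OF assms(1,2,2,3)] measure_standard_chain_simplex[OF assms(1,2)]
  by (simp add: mult.left_commute)

text \<open>A convex set with empty interior is negligible, but here the volume is positive.\<close>

lemma interior_chain_simplex_nonempty:
  fixes f :: "nat \<Rightarrow> 'n::finite"
  assumes "1 \<le> n" "bij_betw f {1..n} (UNIV :: 'n set)" "\<And>k. 0 < w k"
  shows "interior (chain_simplex f w n) \<noteq> {}"
proof -
  have "0 < (\<Prod>k\<in>{1..n}. w k)" using assms(3) by (simp add: prod_pos)
  then have "measure lebesgue (chain_simplex f w n) \<noteq> 0"
    using measure_chain_simplex[where w = w, OF assms] by (metis less_irrefl mult_zero_right)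
  then show ?thesis
    using negligible_imp_measure0 negligible_convex_interior[OF convex_chain_simplex] by blast
qed

text \<open>The scaled coordinates of a vertex are 1,...,1,2,...,2, and the barycentric coordinates
  of a point are the gaps between its consecutive scaled coordinates.\<close>

lemma simplex_chain_simplex:
  fixes f :: "nat \<Rightarrow> 'n::finite"
  assumes n: "1 \<le> n" and f: "bij_betw f {1..n} (UNIV :: 'n set)" and w: "\<And>k. 0 < w k"
  shows "int n simplex chain_simplex f w n"
proof -
  let ?S = "chain_simplex f w n"
  define r where "r = inv_into {1..n} f"
  have rf: "r (f k) = k" if "k \<in> {1..n}" for k
    using f that by (simp add: r_def bij_betw_def)
  have r: "r i \<in> {1..n}" "f (r i) = i" for i
    using f by (metis UNIV_I bij_betw_def inv_into_into r_def, metis UNIV_I bij_betw_def f_inv_into_f r_def)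
  define v :: "nat \<Rightarrow> real ^ 'n" where "v m = (\<chi> i. w (r i) * (if r i \<le> m then 1 else 2))" for m
  let ?C = "v ` {0..n}"
  have vf: "v m $ f k / w k = (if k \<le> m then 1 else 2)" if "k \<in> {1..n}" for m k
    using rf[OF that] w[of k] by (simp add: v_def)
  have "v m \<in> ?S" for m
    using n unfolding chain_simplex_def by (auto simp: vf)
  then have hull1: "convex hull ?C \<subseteq> ?S"
    by (intro hull_minimal convex_chain_simplex) auto
  have hull2: "x \<in> convex hull ?C" if x: "x \<in> ?S" for x
  proof -
    \<comment> \<open>Padding with 1 in front and 2 at the end makes the gaps nonnegative with sum
      1.\<close>
    define y where "y k = (if k = 0 then 1 else if k = Suc n then 2 else x $ f k / w k)" for k
    define c where "c m = y (Suc m) - y m" for m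
    have y: "y k \<le> y (Suc k)" if "k \<le> n" for k
      using x that n by (auto simp: y_def chain_simplex_def le_less Suc_le_eq)
    have tele: "(\<Sum>m<k. c m) = y k - 1" for k
      unfolding c_def by (subst sum_lessThan_telescope) (simp add: y_def)
    have sum1: "(\<Sum>m\<in>{0..n}. c m) = 1"
      using tele[of "Suc n"] by (simp add: y_def lessThan_Suc_atMost atLeast0AtMost)
    have "x $ i = (\<Sum>m\<in>{0..n}. c m *\<^sub>R v m) $ i" for i
    proof -
      define k where "k = r i"
      have k: "k \<in> {1..n}" "f k = i" using r[of i] by (simp_all add: k_def)
      \<comment> \<open>The k-th scaled coordinate of \<open>v m\<close> is 2 exactly if
        \<open>m < k\<close>, so the sum is \<open>w k\<close> times 1 plus the gaps before
        \<open>k\<close>, which telescope.\<close>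
      have "(\<Sum>m\<in>{0..n}. c m *\<^sub>R v m) $ i = (\<Sum>m\<in>{0..n}. w k * (c m + (if m < k then c m else 0)))"
        by (auto simp: v_def k_def[symmetric] intro!: sum.cong)
      also have "\<dots> = w k * ((\<Sum>m\<in>{0..n}. c m) + (\<Sum>m\<in>{0..n}. if m < k then c m else 0))"
        by (simp add: sum_distrib_left[symmetric] sum.distrib)
      also have "(\<Sum>m\<in>{0..n}. if m < k then c m else 0) = (\<Sum>m<k. c m)"
        using k(1) by (intro sum.mono_neutral_cong_right) auto
      also have "w k * ((\<Sum>m\<in>{0..n}. c m) + (\<Sum>m<k. c m)) = w k * y k"
        by (simp add: sum1 tele)
      also have "\<dots> = x $ i"
        using k w[of k] by (simp add: y_def)
      finally show ?thesis by simp
    qed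
    then have "x = (\<Sum>m\<in>{0..n}. c m *\<^sub>R v m)" by (simp add: vec_eq_iff)
    also have "\<dots> \<in> convex hull ?C"
      using y by (intro convex_sum sum1 convex_convex_hull) (auto simp: c_def intro: hull_inc)
    finally show ?thesis .
  qed
  have S: "?S = convex hull ?C" using hull1 hull2 by blast
  \<comment> \<open>A nonempty interior gives dimension \<open>n\<close>, which at most
    \<open>n + 1\<close> points can span only if there are \<open>n + 1\<close> of them and they are
    affinely independent.\<close>
  have "aff_dim ?S = int n"
    using aff_dim_nonempty_interior[OF interior_chain_simplex_nonempty[where w = w, OF n f w]] card_enumerated_UNIV[OF n f] by simp
  then have "aff_dim ?C = int n" unfolding S by (simp only: aff_dim_convex_hull)
  moreover have "card ?C \<le> n + 1" using card_image_le[of "{0..n}" v] by simp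
  moreover have "aff_dim ?C \<le> int (card ?C) - 1" by (intro aff_dim_le_card) simp
  ultimately have "int (card ?C) = int n + 1" "aff_dim ?C = int (card ?C) - 1" by simp_all
  then show ?thesis
    unfolding simplex_def using S affine_independent_iff_card[of ?C]
    by (intro exI[of _ ?C]) simp
qed

section \<open>Tree simplices, codes and binary exponents\<close>

lemma tree_simplex_chain:
  "tree_simplex e n T =
     chain_simplex (\<lambda>k. e (nfs_position (n + 1) T k)) (\<lambda>k. 2 ^ cane_paths_from (n + 1) T k) n"
  by (simp add: tree_simplex_def chain_simplex_def Let_def)

lemma nfs_position_bij:
  assumes T: "labeled_tree (n + 1) T"
  shows "bij_betw (nfs_position (n + 1) T) {1..n} {1..n}"
proof -
  have q: "tree_code n T \<in> tree_codes n" using bij_betwE[OF tree_code_bij] T by blast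
  let ?l = "\<lambda>i. fst (tree_code n T ! i)"
  have "bij_betw (nfs_position (n + 1) T \<circ> ?l) {..<n} {1..n}"
  proof (subst bij_betw_cong[of _ _ Suc])
    show "bij_betw Suc {..<n} {1..n}" by (simp add: bij_betw_def image_Suc_lessThan)
  qed (use nfs_position_tree_code(1)[OF T] in auto)
  then show ?thesis using bij_betw_comp_iff[OF tree_codes_bij_labels[OF q]] by blast
qed

lemma tree_label_at:
  assumes T: "labeled_tree (n + 1) T" and i: "i < n"
  obtains k where "k \<in> {1..n}" "nfs_position (n + 1) T k = Suc i" "tree_code n T ! i = (k, cane_paths_from (n + 1) T k)"
proof
  have q: "tree_code n T \<in> tree_codes n" using bij_betwE[OF tree_code_bij] T by blast
  let ?k = "fst (tree_code n T ! i)"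
  show "?k \<in> {1..n}" using bij_betwE[OF tree_codes_bij_labels[OF q]] i by auto
  show "nfs_position (n + 1) T ?k = Suc i" by (rule nfs_position_tree_code(1)[OF T i])
  show "tree_code n T ! i = (?k, cane_paths_from (n + 1) T ?k)"
    unfolding nfs_position_tree_code(2)[OF T i] by simp
qed

lemma mantissa_unique:
  assumes "1 < x / 2 ^ a" "x / 2 ^ a < 2" "1 < x / 2 ^ b" "x / 2 ^ b < (2 :: real)"
  shows "a = b"
proof -
  have *: "\<not> a < b" if "x / 2 ^ a < 2" "1 < x / 2 ^ b" for a b
  proof
    assume "a < b"
    then have "(2::real) ^ Suc a \<le> 2 ^ b" by (intro power_increasing) auto
    moreover have "x < 2 ^ Suc a" "2 ^ b < x" using that by (simp_all add: field_simps)
    ultimately show False by linarith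
  qed
  show ?thesis using *[of a b] *[of b a] assms by linarith
qed

text \<open>The least exponent is chosen: a power of 2 greater than 1 gets scaled value 2, not 1. So
  the value 1 is attained only with exponent 0.\<close>

lemma mantissa_exists:
  assumes "1 \<le> (x :: real)"
  shows "\<exists>j::nat. 1 \<le> x / 2 ^ j \<and> x / 2 ^ j \<le> 2 \<and> (j = 0 \<or> 1 < x / 2 ^ j)"
proof -
  define j where "j = (LEAST j. x \<le> 2 ^ Suc j)"
  obtain m where "x < 2 ^ m" using real_arch_pow[of 2 x] by auto
  moreover have "(2::real) ^ m \<le> 2 ^ Suc m" by simp
  ultimately have "x \<le> 2 ^ Suc m" by linarith
  then have j: "x \<le> 2 ^ Suc j" unfolding j_def by (rule LeastI)
  show ?thesis
  proof (cases j)
    case 0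
    then show ?thesis using assms j by (intro exI[of _ 0]) simp
  next
    case (Suc i)
    then have "\<not> x \<le> 2 ^ Suc i" unfolding j_def by (intro not_less_Least) simp
    then show ?thesis using j Suc by (intro exI[of _ j]) (simp add: field_simps)
  qed
qed

context
  fixes n :: nat and e :: "nat \<Rightarrow> 'n::finite"
  assumes n: "n \<ge> 1" and e: "bij_betw e {1..n} (UNIV :: 'n set)"
begin

lemma tree_vertices_bij:
  assumes "labeled_tree (n + 1) T"
  shows "bij_betw (\<lambda>k. e (nfs_position (n + 1) T k)) {1..n} UNIV"
  using bij_betw_trans[OF nfs_position_bij[OF assms] e] by (simp add: comp_def)

lemma measure_tree_simplex:
  assumes T: "labeled_tree (n + 1) T"
  shows "fact n * measure lebesgue (tree_simplex e n T) = 2 ^ cane_paths_total (n + 1) T"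
proof -
  have q: "tree_code n T \<in> tree_codes n" using bij_betwE[OF tree_code_bij] T by blast
  have "fact n * measure lebesgue (tree_simplex e n T) = (\<Prod>k\<in>{1..n}. 2 ^ cane_paths_from (n + 1) T k)"
    unfolding tree_simplex_chain by (rule measure_chain_simplex[OF n tree_vertices_bij[OF T]]) simp
  also have "\<dots> = 2 ^ (\<Sum>k\<in>{1..n}. cane_paths_from (n + 1) T k)" by (simp add: power_sum)
  also have "(\<Sum>k\<in>{1..n}. cane_paths_from (n + 1) T k) = (\<Sum>i<n. snd (tree_code n T ! i))"
    using sum.reindex_bij_betw[OF tree_codes_bij_labels[OF q], of "cane_paths_from (n + 1) T"]
      nfs_position_tree_code(2)[OF T] by simp
  finally show ?thesis unfolding cane_paths_total_tree_code[OF T] .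
qed

text \<open>If the exponent does not rise between consecutive positions, the bounds 1 and 2 suffice
  for the doubling inequality; if it rises by one, the smaller label supplies the comparison of
  scaled values.\<close>

lemma tree_simplex_subset_cayley:
  assumes T: "labeled_tree (n + 1) T" and x: "x \<in> tree_simplex e n T"
  shows "x \<in> cayley_polytope e n"
proof -
  have q: "tree_code n T \<in> tree_codes n" using bij_betwE[OF tree_code_bij] T by blast
  let ?c = "cane_paths_from (n + 1) T"
  note xc = x[unfolded tree_simplex_chain]
  note mono = chain_simplex_mono[OF n tree_vertices_bij[OF T] xc]
  note bounds = chain_simplex_bounds[OF n tree_vertices_bij[OF T] xc]
  have val: "\<exists>k. k \<in> {1..n} \<and> tree_code n T ! i = (k, ?c k) \<and> nfs_position (n + 1) T k = Suc i \<and>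
      2 ^ ?c k \<le> x $ e (Suc i) \<and> x $ e (Suc i) \<le> 2 * 2 ^ ?c k" if i: "i < n" for i
  proof -
    obtain k where k: "k \<in> {1..n}" "nfs_position (n + 1) T k = Suc i" "tree_code n T ! i = (k, ?c k)"
      using tree_label_at[OF T i] .
    then show ?thesis using bounds[of k] by (intro exI[of _ k]) (simp add: field_simps)
  qed
  have ge1: "1 \<le> x $ e (Suc i)" if i: "i < n" for i
    using val[OF i] one_le_power[of "2::real"] by (meson order_trans one_le_numeral)
  obtain k0 where k0: "tree_code n T ! 0 = (k0, ?c k0)" "x $ e 1 \<le> 2 * 2 ^ ?c k0"
    using val[of 0] n by auto
  have "snd (hd (tree_code n T)) = 0" "tree_code n T \<noteq> []"
    using q n by (auto simp: tree_codes_def starts_below_def)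
  then have "?c k0 = 0" using k0(1) by (simp add: hd_conv_nth)
  then have "x $ e 1 \<le> 2" using k0(2) by simp
  moreover have dbl: "x $ e (Suc (Suc i)) \<le> 2 * x $ e (Suc i)" if i: "Suc i < n" for i
  proof -
    obtain k where k: "k \<in> {1..n}" "tree_code n T ! i = (k, ?c k)" "nfs_position (n + 1) T k = Suc i"
      "2 ^ ?c k \<le> x $ e (Suc i)" using val[of i] i by auto
    obtain l where l: "l \<in> {1..n}" "tree_code n T ! Suc i = (l, ?c l)" "nfs_position (n + 1) T l = Suc (Suc i)"
      "x $ e (Suc (Suc i)) \<le> 2 * 2 ^ ?c l" using val[of "Suc i"] i by auto
    have "admissible (k, ?c k) (l, ?c l)"
      using successively_nth[of admissible "tree_code n T" i] q i k(2) l(2) by (simp add: tree_codes_def)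
    then consider "?c l \<le> ?c k" | "?c l = Suc (?c k)" "l < k" by (auto simp: admissible_def)
    then show ?thesis
    proof cases
      case 1
      then have "(2::real) ^ ?c l \<le> 2 ^ ?c k" by (intro power_increasing) auto
      then show ?thesis using k l by linarith
    next
      case 2
      then show ?thesis using mono[of l k] k l by (simp add: field_simps)
    qed
  qed
  moreover have "1 \<le> x $ e i \<and> x $ e i \<le> 2 * x $ e (i - 1)" if i: "i \<in> {2..n}" for i
  proof -
    obtain j where "i = Suc (Suc j)" "Suc j < n"
      using i by (metis Suc_le_eq Suc_le_D atLeastAtMost_iff numeral_2_eq_2 Suc_le_mono)
    then show ?thesis using dbl[of j] ge1[of "Suc j"] by simp
  qed
  ultimately show ?thesis
    using ge1[of 0] n by (simp add: cayley_polytope_def)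
qed

text \<open>Exponents and ranks are read off from the point, with conventions for the boundary, and
  shown to form a code; its tree is the one sought.\<close>

lemma cayley_subset_tree_simplices:
  assumes x: "x \<in> cayley_polytope e n"
  shows "\<exists>T. labeled_tree (n + 1) T \<and> x \<in> tree_simplex e n T"
proof -
  have x1: "1 \<le> x $ e i" if "i \<in> {1..n}" for i
    using x that by (cases "i = 1") (auto simp: cayley_polytope_def)
  obtain J :: "nat \<Rightarrow> nat" where J: "\<And>i. i \<in> {1..n} \<Longrightarrow> 1 \<le> x $ e i / 2 ^ J i \<and> x $ e i / 2 ^ J i \<le> 2 \<and>
      (J i = 0 \<or> 1 < x $ e i / 2 ^ J i)"
    using mantissa_exists[OF x1] by metis
  define Y where "Y i = x $ e i / 2 ^ J i" for i
  have Y: "1 \<le> Y i" "Y i \<le> 2" "J i = 0 \<or> 1 < Y i" "x $ e i = Y i * 2 ^ J i" if "i \<in> {1..n}" for i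
    using J[OF that] by (simp_all add: Y_def)
  \<comment> \<open>Equal scaled values are ranked with the later position first, so that an
    exponent rising by one lowers the label also when the scaled values agree.\<close>
  define R where "R i j \<longleftrightarrow> Y i < Y j \<or> (Y i = Y j \<and> j < i)" for i j
  have "\<exists>l. bij_betw l {1..n} {1..n} \<and> (\<forall>a\<in>{1..n}. \<forall>b\<in>{1..n}. R a b \<longleftrightarrow> l a < (l b :: nat))"
    by (rule rank_bij) (auto simp: R_def)
  then obtain l where l: "bij_betw l {1..n} {1..n}" "\<And>a b. a \<in> {1..n} \<Longrightarrow> b \<in> {1..n} \<Longrightarrow> R a b \<longleftrightarrow> l a < l b"
    by blast
  \<comment> \<open>A positive exponent comes with a scaled value above 1 and would make the first
    coordinate exceed 2.\<close>
  have JSuc: "J 1 = 0"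
  proof (rule ccontr)
    assume "J 1 \<noteq> 0"
    then have "(2::real) ^ 1 \<le> 2 ^ J 1" by (intro power_increasing) auto
    moreover have "1 < Y 1" using Y(3)[of 1] n \<open>J 1 \<noteq> 0\<close> by auto
    ultimately have "1 * 2 < Y 1 * 2 ^ J 1" by (intro mult_less_le_imp_less) auto
    then show False using Y(4)[of 1] n x by (simp add: cayley_polytope_def)
  qed
  have step: "admissible (l i, J i) (l (Suc i), J (Suc i))" if i: "i \<in> {1..n}" "Suc i \<in> {1..n}" for i
  proof -
    have "\<forall>i\<in>{2..n}. x $ e i \<le> 2 * x $ e (i - 1)" using x by (simp add: cayley_polytope_def)
    from bspec[OF this, of "Suc i"] have "Y (Suc i) * 2 ^ J (Suc i) \<le> Y i * 2 ^ Suc (J i)"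
      using i Y(4)[OF i(1)] Y(4)[OF i(2)] by simp
    \<comment> \<open>A rise by two would give a coordinate above \<open>4 * 2 ^ J i\<close>,
      whereas twice the preceding one is at most that.\<close>
    moreover have "\<not> J (Suc i) > Suc (J i)" 
    proof
      assume less: "J (Suc i) > Suc (J i)"
      then have "(2::real) ^ Suc (Suc (J i)) \<le> 2 ^ J (Suc i)" by (intro power_increasing) auto
      moreover have "1 < Y (Suc i)" using Y(3)[OF i(2)] less by auto
      ultimately have "1 * 2 ^ Suc (Suc (J i)) < Y (Suc i) * 2 ^ J (Suc i)"
        by (intro mult_less_le_imp_less) auto
      also have "\<dots> \<le> Y i * 2 ^ Suc (J i)" by fact
      also have "\<dots> \<le> 2 * 2 ^ Suc (J i)" using Y(2)[OF i(1)] by (intro mult_right_mono) auto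
      finally show False by simp
    qed
    moreover have "l (Suc i) < l i" if "J (Suc i) = Suc (J i)" 
    proof -
      have "Y (Suc i) \<le> Y i" using that calculation(1) by simp
      then have "R (Suc i) i" by (auto simp: R_def)
      then show ?thesis using l(2) i by blast
    qed
    ultimately show ?thesis by (auto simp: admissible_def)
  qed
  define q where "q = map (\<lambda>i. (l (Suc i), J (Suc i))) [0..<n]"
  have lS: "bij_betw (\<lambda>i. l (Suc i)) {0..<n} {1..n}"
  proof -
    have "bij_betw Suc {0..<n} {1..n}" by (simp add: bij_betw_def atLeastLessThanSuc_atLeastAtMost)
    from bij_betw_trans[OF this l(1)] show ?thesis by (simp add: comp_def)
  qed
  have mq: "map fst q = map (\<lambda>i. l (Suc i)) [0..<n]" by (simp add: q_def)
  have "distinct (map fst q)"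
    unfolding mq distinct_map using lS by (simp add: bij_betw_def)
  moreover have "fst ` set q = {1..n}"
    using lS by (simp add: q_def image_image bij_betw_def)
  moreover have "successively admissible q"
    unfolding successively_conv_nth q_def using step by simp
  moreover have "starts_below 1 q"
    using n JSuc by (simp add: starts_below_def q_def hd_map upt_conv_Cons)
  ultimately have "q \<in> tree_codes n"
    by (simp add: tree_codes_def q_def)
  then obtain T where T: "labeled_tree (n + 1) T" "tree_code n T = q"
    using bij_betw_imp_surj_on[OF tree_code_bij] by (metis (no_types, lifting) imageE mem_Collect_eq)
  let ?c = "cane_paths_from (n + 1) T" and ?p = "nfs_position (n + 1) T"
  have lab: "x $ e (?p k) / 2 ^ ?c k = Y i" if i: "i \<in> {1..n}" "l i = k" for i k
  proof -
    obtain i' where i': "i = Suc i'" "i' < n" using i(1) by (cases i) auto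
    obtain k' where "k' \<in> {1..n}" "?p k' = i" "q ! i' = (k', ?c k')"
      using tree_label_at[OF T(1) i'(2)] unfolding T(2) i'(1) by blast
    then show ?thesis using i i' by (auto simp: q_def Y_def)
  qed
  have ex: "\<exists>i\<in>{1..n}. l i = k" if "k \<in> {1..n}" for k
    using l(1) that by (metis bij_betw_imp_surj_on imageE)
  have "x $ e (?p k) / 2 ^ ?c k \<le> x $ e (?p (k + 1)) / 2 ^ ?c (k + 1)" if k: "k \<in> {1..<n}" for k
  proof -
    obtain i j where ij: "i \<in> {1..n}" "l i = k" "j \<in> {1..n}" "l j = k + 1"
      using ex[of k] ex[of "k + 1"] k by auto
    then have "R i j" using l(2) by simp
    then show ?thesis unfolding lab[OF ij(1,2)] lab[OF ij(3,4)] by (auto simp: R_def)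
  qed
  moreover have "1 \<le> x $ e (?p k) / 2 ^ ?c k" "x $ e (?p k) / 2 ^ ?c k \<le> 2" if "k \<in> {1..n}" for k
    using ex[OF that] lab Y(1,2) by metis+
  ultimately have "x \<in> tree_simplex e n T"
    unfolding tree_simplex_chain chain_simplex_def using n by auto
  then show ?thesis using T(1) by blast
qed

text \<open>At an interior point every scaled coordinate lies strictly between 1 and 2, so the
  coordinates alone give the exponents. The scaled coordinates are then known and strictly ordered,
  which gives the labels and hence the code.\<close>

lemma tree_simplex_interior_inter:
  assumes T: "labeled_tree (n + 1) T" and T': "labeled_tree (n + 1) T'"
    and x: "x \<in> interior (tree_simplex e n T)" "x \<in> interior (tree_simplex e n T')"
  shows "T = T'"
proof -
  let ?c = "cane_paths_from (n + 1)" and ?p = "nfs_position (n + 1)"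
  have ei: "inj_on e {1..n}" using e by (simp add: bij_betw_def)
  have strict: "x $ e (?p T j) / 2 ^ ?c T j < x $ e (?p T k) / 2 ^ ?c T k"
    if T: "labeled_tree (n + 1) T" and x: "x \<in> interior (tree_simplex e n T)"
      and jk: "1 \<le> j" "j < k" "k \<le> n" for T j k
  proof -
    note i = interior_chain_simplex_strict(2)[OF n tree_vertices_bij[OF T] _ x[unfolded tree_simplex_chain], of j]
    have "x \<in> tree_simplex e n T" using x interior_subset by blast
    note m = chain_simplex_mono[OF n tree_vertices_bij[OF T] this[unfolded tree_simplex_chain], of "j + 1" k]
    show ?thesis using i m jk by simp
  qed
  have bounds: "1 < x $ e (?p T k) / 2 ^ ?c T k" "x $ e (?p T k) / 2 ^ ?c T k < 2"
    if T: "labeled_tree (n + 1) T" and x: "x \<in> interior (tree_simplex e n T)" and k: "k \<in> {1..n}" for T k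
  proof -
    have pos: "0 < (2::real) ^ ?c T k" for k by simp
    note i = interior_chain_simplex_strict(1,3)[OF n tree_vertices_bij[OF T] pos x[unfolded tree_simplex_chain]]
    have "x \<in> tree_simplex e n T" using x interior_subset by blast
    note m = chain_simplex_mono[OF n tree_vertices_bij[OF T] this[unfolded tree_simplex_chain]]
    show "1 < x $ e (?p T k) / 2 ^ ?c T k" using i(1) m[of 1 k] k by (meson atLeastAtMost_iff less_le_trans order_refl)
    show "x $ e (?p T k) / 2 ^ ?c T k < 2" using i(2) m[of k n] k by (meson atLeastAtMost_iff le_less_trans order_refl)
  qed
  have exps: "snd (tree_code n T ! i) = snd (tree_code n T' ! i)" if i: "i < n" for i
  proof -
    obtain k where k: "k \<in> {1..n}" "?p T k = Suc i" "tree_code n T ! i = (k, ?c T k)"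
      using tree_label_at[OF T i] .
    obtain k' where k': "k' \<in> {1..n}" "?p T' k' = Suc i" "tree_code n T' ! i = (k', ?c T' k')"
      using tree_label_at[OF T' i] .
    show ?thesis
      using mantissa_unique bounds[OF T x(1) k(1)] bounds[OF T' x(2) k'(1)] k k' by auto
  qed
  define r where "r = inv_into {1..n} e"
  have re: "r (e i) = i" if "i \<in> {1..n}" for i using ei that by (simp add: r_def)
  \<comment> \<open>Scaled values as a function of the coordinate alone; the exponents are taken
    from \<open>T\<close> but agree with those of \<open>T'\<close>. The coordinate numbered
    \<open>i\<close> has its code entry at index \<open>i - 1\<close>.\<close>
  define z where "z c = x $ c / 2 ^ snd (tree_code n T ! (r c - 1))" for c
  have z: "z (e (?p S k)) = x $ e (?p S k) / 2 ^ ?c S k"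
    if S: "S = T \<or> S = T'" and k: "k \<in> {1..n}" for S k
  proof -
    have S': "labeled_tree (n + 1) S" using S T T' by auto
    have p: "?p S k \<in> {1..n}" using bij_betwE[OF nfs_position_bij[OF S']] k by blast
    then have i: "?p S k - 1 < n" by auto
    obtain k' where k': "k' \<in> {1..n}" "?p S k' = Suc (?p S k - 1)" "tree_code n S ! (?p S k - 1) = (k', ?c S k')"
      using tree_label_at[OF S' i] .
    then have "k' = k"
      using bij_betw_imp_inj_on[OF nfs_position_bij[OF S']] k p by (auto dest: inj_onD)
    then have "snd (tree_code n T ! (?p S k - 1)) = ?c S k"
      using k'(3) exps[OF i] S by auto
    then show ?thesis unfolding z_def re[OF p] by simp
  qed
  have same: "?p T k = ?p T' k" if k: "k \<in> {1..n}" for k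
  proof -
    have "e (?p T k) = e (?p T' k)"
    proof (rule chain_order_unique[OF n tree_vertices_bij[OF T] tree_vertices_bij[OF T'], of z])
      show "z (e (?p T i)) < z (e (?p T j))" if "1 \<le> i" "i < j" "j \<le> n" for i j
        using strict[OF T x(1) that] z[of T i] z[of T j] that by simp
      show "z (e (?p T' i)) < z (e (?p T' j))" if "1 \<le> i" "i < j" "j \<le> n" for i j
        using strict[OF T' x(2) that] z[of T' i] z[of T' j] that by simp
    qed (rule k)
    then show ?thesis
      using ei bij_betwE[OF nfs_position_bij[OF T]] bij_betwE[OF nfs_position_bij[OF T']] k
      by (auto dest: inj_onD)
  qed
  have q: "tree_code n T \<in> tree_codes n" "tree_code n T' \<in> tree_codes n"
    using bij_betwE[OF tree_code_bij] T T' by blast+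
  have "tree_code n T = tree_code n T'"
  proof (rule nth_equalityI)
    show "length (tree_code n T) = length (tree_code n T')" using q by (simp add: tree_codes_def)
    fix i assume "i < length (tree_code n T)"
    then have i: "i < n" using q by (simp add: tree_codes_def)
    obtain k where k: "k \<in> {1..n}" "?p T k = Suc i" "tree_code n T ! i = (k, ?c T k)"
      using tree_label_at[OF T i] .
    obtain k' where k': "k' \<in> {1..n}" "?p T' k' = Suc i" "tree_code n T' ! i = (k', ?c T' k')"
      using tree_label_at[OF T' i] .
    have "k = k'"
      using inj_onD[OF bij_betw_imp_inj_on[OF nfs_position_bij[OF T]] _ k(1) k'(1)]
        same[OF k'(1)] k(2) k'(2) by simp
    then show "tree_code n T ! i = tree_code n T' ! i"
      using exps[OF i] k k' by simp
  qed
  then show ?thesis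
    using bij_betw_imp_inj_on[OF tree_code_bij] T T' by (auto dest: inj_onD)
qed

section \<open>The polytope as the union of its simplices\<close>

lemma cayley_polytope_eq: "cayley_polytope e n = \<Union> (tree_simplex e n ` {T. labeled_tree (n + 1) T})"
  using tree_simplex_subset_cayley cayley_subset_tree_simplices by auto

lemma convex_cayley_polytope: "convex (cayley_polytope e n)"
proof (rule convexI)
  fix x y :: "real ^ 'n" and u v :: real
  assume xy: "x \<in> cayley_polytope e n" "y \<in> cayley_polytope e n" and uv: "0 \<le> u" "0 \<le> v" "u + v = 1"
  have mono: "u * a + v * b \<le> u * c + v * d" if "a \<le> c" "b \<le> d" for a b c d
    using that uv by (intro add_mono mult_left_mono)
  have const: "u * c + v * c = c" for c
    using uv by (metis distrib_right mult_1)
  have dbl: "2 * (u * a + v * b) = u * (2 * a) + v * (2 * b)" for a b :: real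
    by (simp add: algebra_simps)
  show "u *\<^sub>R x + v *\<^sub>R y \<in> cayley_polytope e n"
    using xy mono[of 1 _ 1] mono[of _ 2 _ 2] mono const[of 1] const[of 2]
    unfolding cayley_polytope_def mem_Collect_eq vector_add_component vector_scaleR_component
      real_scaleR_def dbl by metis
qed

lemma simplex_tree_simplex:
  assumes "labeled_tree (n + 1) T"
  shows "int n simplex tree_simplex e n T"
  unfolding tree_simplex_chain by (rule simplex_chain_simplex[OF n tree_vertices_bij[OF assms]]) simp

text \<open>The set is convex by its inequalities and a finite union of simplices, hence the convex
  hull of all their vertices together.\<close>

lemma polytope_cayley_polytope: "polytope (cayley_polytope e n)"
proof -
  let ?TT = "{T. labeled_tree (n + 1) T}"
  have "\<forall>T\<in>?TT. \<exists>C. finite C \<and> tree_simplex e n T = convex hull C"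
    using simplex_tree_simplex simplex_imp_polytope unfolding polytope_def by blast
  then obtain C where C: "\<And>T. T \<in> ?TT \<Longrightarrow> finite (C T)" "\<And>T. T \<in> ?TT \<Longrightarrow> tree_simplex e n T = convex hull (C T)"
    by metis
  have "cayley_polytope e n = convex hull (\<Union>T\<in>?TT. C T)"
  proof
    show "cayley_polytope e n \<subseteq> convex hull (\<Union>T\<in>?TT. C T)"
      unfolding cayley_polytope_eq using C(2) by (auto intro!: UN_least hull_mono dest: subsetD[OF hull_mono, rotated]) 
    have "C T \<subseteq> cayley_polytope e n" if "T \<in> ?TT" for T
      using C(2)[OF that] hull_subset[of "C T" convex] that unfolding cayley_polytope_eq by blast
    then show "convex hull (\<Union>T\<in>?TT. C T) \<subseteq> cayley_polytope e n"
      by (intro hull_minimal convex_cayley_polytope) blast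
  qed
  moreover have "finite (\<Union>T\<in>?TT. C T)" using C(1) finite_labeled_trees by blast
  ultimately show ?thesis unfolding polytope_def by blast
qed

lemma measure_cayley_polytope:
  "measure lebesgue (cayley_polytope e n) =
     (\<Sum>T | labeled_tree (n + 1) T. measure lebesgue (tree_simplex e n T))"
  unfolding cayley_polytope_eq
proof (rule measure_negligible_finite_Union_image[OF finite_labeled_trees])
  show "tree_simplex e n T \<in> lmeasurable" if "T \<in> {T. labeled_tree (n + 1) T}" for T
    using that lmeasurable_chain_simplex[OF n tree_vertices_bij] unfolding tree_simplex_chain by simp
  have "negligible (tree_simplex e n T \<inter> tree_simplex e n T')"
    if "labeled_tree (n + 1) T" "labeled_tree (n + 1) T'" "T \<noteq> T'" for T T'
  proof -
    have "convex (tree_simplex e n T \<inter> tree_simplex e n T')"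
      unfolding tree_simplex_chain by (intro convex_Int convex_chain_simplex)
    moreover have "interior (tree_simplex e n T \<inter> tree_simplex e n T') = {}"
      using tree_simplex_interior_inter that by auto
    ultimately show ?thesis by (simp add: negligible_convex_interior)
  qed
  then show "pairwise (\<lambda>T T'. negligible (tree_simplex e n T \<inter> tree_simplex e n T')) {T. labeled_tree (n + 1) T}"
    by (auto simp: pairwise_def)
qed

text \<open>Equal simplices would share a nonempty interior, which belongs to one tree only. So the
  triangulation, as a set, has one simplex for each tree.\<close>

lemma inj_on_tree_simplex: "inj_on (tree_simplex e n) {T. labeled_tree (n + 1) T}"
proof (rule inj_onI)
  fix T T' assume T: "T \<in> {T. labeled_tree (n + 1) T}" "T' \<in> {T. labeled_tree (n + 1) T}"
    and eq: "tree_simplex e n T = tree_simplex e n T'"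
  have "interior (tree_simplex e n T) \<noteq> {}"
    unfolding tree_simplex_chain using T(1)
    by (intro interior_chain_simplex_nonempty[OF n tree_vertices_bij]) simp_all
  then obtain x where "x \<in> interior (tree_simplex e n T)" by blast
  moreover from this have "x \<in> interior (tree_simplex e n T')" unfolding eq .
  ultimately show "T = T'" using tree_simplex_interior_inter T unfolding mem_Collect_eq by blast
qed

end

theorem theorem3p2:
  fixes n :: nat and e :: "nat \<Rightarrow> 'n::finite"
  assumes "n \<ge> 1" and "bij_betw e {1..n} (UNIV :: 'n set)"
  shows "(\<forall>T. labeled_tree (n + 1) T \<longrightarrow>
             int n simplex tree_simplex e n T \<and>
             fact n * measure lebesgue (tree_simplex e n T) =
               real (card {G. labeled_graph (n + 1) G \<and> lg_connected (n + 1) G \<and>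
                              nfs_forest (n + 1) G = T}) \<and>
             card {G. labeled_graph (n + 1) G \<and> lg_connected (n + 1) G \<and>
                      nfs_forest (n + 1) G = T} = 2 ^ cane_paths_total (n + 1) T) \<and>
         inj_on (tree_simplex e n) {T. labeled_tree (n + 1) T} \<and>
         polytope_triangulation (tree_simplex e n ` {T. labeled_tree (n + 1) T})
           (cayley_polytope e n) \<and>
         fact n * measure lebesgue (cayley_polytope e n) =
           real (card {G. labeled_graph (n + 1) G \<and> lg_connected (n + 1) G})"
proof (intro conjI allI impI)
  note a = assms
  have vol: "fact n * measure lebesgue (tree_simplex e n T) =
      real (card {G. labeled_graph (n + 1) G \<and> lg_connected (n + 1) G \<and> nfs_forest (n + 1) G = T})"
    if "labeled_tree (n + 1) T" for T
    using measure_tree_simplex[OF a that] card_nfs_forest_fiber[OF that] by simp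
  show "int n simplex tree_simplex e n T" if "labeled_tree (n + 1) T" for T
    by (rule simplex_tree_simplex[OF a that])
  show "fact n * measure lebesgue (tree_simplex e n T) =
      real (card {G. labeled_graph (n + 1) G \<and> lg_connected (n + 1) G \<and> nfs_forest (n + 1) G = T})"
    if "labeled_tree (n + 1) T" for T
    by (rule vol[OF that])
  show "card {G. labeled_graph (n + 1) G \<and> lg_connected (n + 1) G \<and> nfs_forest (n + 1) G = T} =
      2 ^ cane_paths_total (n + 1) T" if "labeled_tree (n + 1) T" for T
    by (rule card_nfs_forest_fiber[OF that])
  show "inj_on (tree_simplex e n) {T. labeled_tree (n + 1) T}"
    by (rule inj_on_tree_simplex[OF a])
  show "polytope_triangulation (tree_simplex e n ` {T. labeled_tree (n + 1) T}) (cayley_polytope e n)"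
    unfolding polytope_triangulation_def
  proof (intro conjI ballI)
    show "polytope (cayley_polytope e n)" by (rule polytope_cayley_polytope[OF a])
    show "int CARD('n) simplex S" if "S \<in> tree_simplex e n ` {T. labeled_tree (n + 1) T}" for S
      using that simplex_tree_simplex[OF a] card_enumerated_UNIV[OF a] by auto
    show "\<Union> (tree_simplex e n ` {T. labeled_tree (n + 1) T}) = cayley_polytope e n"
      by (rule cayley_polytope_eq[OF a, symmetric])
    show "pairwise (\<lambda>S S'. interior S \<inter> interior S' = {}) (tree_simplex e n ` {T. labeled_tree (n + 1) T})"
      using tree_simplex_interior_inter[OF a] by (fastforce simp: pairwise_def)
  qed
  have "fact n * measure lebesgue (cayley_polytope e n) =
      (\<Sum>T | labeled_tree (n + 1) T. fact n * measure lebesgue (tree_simplex e n T))"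
    by (simp only: measure_cayley_polytope[OF a] sum_distrib_left)
  also have "\<dots> = (\<Sum>T | labeled_tree (n + 1) T.
      real (card {G. labeled_graph (n + 1) G \<and> lg_connected (n + 1) G \<and> nfs_forest (n + 1) G = T}))"
    using vol by (intro sum.cong) auto
  also have "\<dots> = real (card {G. labeled_graph (n + 1) G \<and> lg_connected (n + 1) G})"
    using card_connected_graphs[of "n + 1"] by simp
  finally show "fact n * measure lebesgue (cayley_polytope e n) =
      real (card {G. labeled_graph (n + 1) G \<and> lg_connected (n + 1) G})" .
qed

end
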